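(* Let $\mathbb V_1$ be the variety generated by the $\mathsf{MS4}$-algebra $\mathfrak B_1$ (defined in the context). Then: (1) $\mathbb V_1$ is a variety of $\mathsf{MGrz}$-algebras such that $\mathcal O(\mathbb V_1)$ is not a variety of monadic Heyting algebras. (2) $\mathsf S$ and $\mathcal O$ do not commute, i.e. there is a class $\mathbb K$ of $\mathsf{MS4}$-algebras such that $\mathsf S\mathcal O(\mathbb K)\neq\mathcal O\mathsf S(\mathbb K)$. (3) $\mathsf S\mathcal O$ does not commute with binary intersections, i.e. there are varieties $\mathbb V,\mathbb W$ of $\mathsf{MGrz}$-algebras with $\mathsf S\mathcal O(\mathbb V\cap\mathbb W)\neq\mathsf S\mathcal O(\mathbb V)\cap\mathsf S\mathcal O(\mathbb W)$. (4) $\mathsf S\mathcal O$ is not one-to-one, i.e. there are distinct varieties $\mathbb V\neq\mathbb W$ of $\mathsf{MGrz}$-algebras with $\mathsf S\mathcal O(\mathbb V)=\mathsf S\mathcal O(\mathbb W)$.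
   Context: A monadic Heyting algebra is a tuple $(H,\forall,\exists)$ where $H$ is a Heyting algebra and $\forall,\exists$ are unary functions on $H$ satisfying, for all $a,b\in H$: $\forall(a\wedge b)=\forall a\wedge\forall b$, $\forall a\le a$, $\forall a\le\forall\forall a$, $\exists(a\vee b)=\exists a\vee\exists b$, $a\le\exists a$, $\exists\exists a\le\exists a$, $\exists a\wedge\exists b\le\exists(\exists a\wedge b)$, $\exists\forall a=\forall a$, $\exists a=\forall\exists a$. An $\mathsf{MS4}$-algebra is a tuple $(B,\Box,\forall)$ where $B$ is a boolean algebra, $(B,\Box)$ is an $\mathsf{S4}$-algebra ($\Box1=1$, $\Box(a\wedge b)=\Box a\wedge\Box b$, $\Box a\le a$, $\Box a\le\Box\Box a$), $(B,\forall)$ is an $\mathsf{S5}$-algebra (the same identities for $\forall$ and $\neg\forall a\le\forall\neg\forall a$), and $\Box\forall a\le\forall\Box a$; put $\exists a=\neg\forall\neg a$. An $\mathsf{MGrz}$-algebra is an $\mathsf{MS4}$-algebra satisfying $\Box(\Box(a\to\Box a)\to a)\le a$ for all $a$. For an $\mathsf{MS4}$-algebra $\mathfrak B=(B,\Box,\forall)$, $\mathcal O(\mathfrak B)=(H,\forall_H,\exists_H)$, where $H=\{a\in B:\Box a=a\}$ is the Heyting algebra of open elements (a bounded sublattice of $B$ with $a\to_H b=\Box(\neg a\vee b)$), $\forall_Ha=\Box\forall a$, $\exists_Ha=\exists a$; it is a monadic Heyting algebra. For a class $\mathbb K$ of $\mathsf{MS4}$-algebras, $\mathcal O(\mathbb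 K)=\{\mathcal O(\mathfrak B):\mathfrak B\in\mathbb K\}$. $\mathsf S(\mathbb K)$ is the class of subalgebras of members of $\mathbb K$. Classes of algebras are considered up to isomorphism. Let $\mathfrak K_1=(Y_1,R_1,E_1)$, where $Y_1=\{u,v,w,z\}$, $R_1$ is the partial order (reflexive) whose strict relations are $uR_1v$, $uR_1w$, $uR_1z$, $vR_1z$, $wR_1z$, and $E_1$ is the equivalence relation with classes $\{u\},\{w\},\{v,z\}$. The $\mathsf{MS4}$-algebra $\mathfrak B_1$ is the powerset boolean algebra of $Y_1$ with $\Box U=Y_1\setminus R_1^{-1}[Y_1\setminus U]$ and $\forall U=Y_1\setminus E_1[Y_1\setminus U]$. *)

theory Defs
  imports Main
begin

section \<open>Algebras with a carrier, and classes of algebras up to isomorphism\<close>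

class signature =
  fixes arity :: "'a \<Rightarrow> nat"

record ('f, 'a) alg =
  carrier :: "'a set"
  interp :: "'f \<Rightarrow> 'a list \<Rightarrow> 'a"

definition is_algebra :: "('f::signature, 'a) alg \<Rightarrow> bool" where
  "is_algebra A \<longleftrightarrow>
     (\<forall>f xs. length xs = arity f \<and> set xs \<subseteq> carrier A \<longrightarrow> interp A f xs \<in> carrier A)"

definition hom :: "('f::signature, 'a) alg \<Rightarrow> ('f, 'b) alg \<Rightarrow> ('a \<Rightarrow> 'b) set" where
  "hom A B = {h. h ` carrier A \<subseteq> carrier B \<and>
     (\<forall>f xs. length xs = arity f \<and> set xs \<subseteq> carrier A \<longrightarrow>
        h (interp A f xs) = interp B f (map h xs))}"

definition isomorphic :: "('f::signature, 'a) alg \<Rightarrow> ('f, 'b) alg \<Rightarrow> bool" (infix "\<cong>" 50) where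
  "A \<cong> B \<longleftrightarrow> is_algebra A \<and> is_algebra B \<and> (\<exists>h \<in> hom A B. bij_betw h (carrier A) (carrier B))"

definition subalgebra :: "('f::signature, 'a) alg \<Rightarrow> ('f, 'a) alg \<Rightarrow> bool" where
  "subalgebra A B \<longleftrightarrow> is_algebra A \<and> carrier A \<subseteq> carrier B \<and>
     (\<forall>f xs. length xs = arity f \<and> set xs \<subseteq> carrier A \<longrightarrow> interp A f xs = interp B f xs)"

definition subalgebras :: "('f::signature, 'a) alg set \<Rightarrow> ('f, 'a) alg set" ("\<S>") where
  "\<S> K = {A. \<exists>B\<in>K. \<exists>C. subalgebra C B \<and> A \<cong> C}"


section \<open>Varieties\<close>

text \<open>
  A class of algebras is a set of algebras whose carriers are subsets of a type \<open>'a\<close>, which plays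
  the role of the universe. Varieties are equational classes; unlike closure under
  homomorphic images, subalgebras and arbitrary products, this does not depend on whether the
  products still fit into \<open>'a\<close>. Two algebras that differ only in the values of the operations
  outside the carrier are isomorphic, and all classes built below are closed under isomorphism.
\<close>

datatype 'f trm = Var nat | App 'f "'f trm list"

fun wf_trm :: "'f::signature trm \<Rightarrow> bool" where
  "wf_trm (Var n) = True"
| "wf_trm (App f ts) = (length ts = arity f \<and> (\<forall>t\<in>set ts. wf_trm t))"

fun eval_trm :: "('f, 'a) alg \<Rightarrow> (nat \<Rightarrow> 'a) \<Rightarrow> 'f trm \<Rightarrow> 'a" where
  "eval_trm A \<sigma> (Var n) = \<sigma> n"
| "eval_trm A \<sigma> (App f ts) = interp A f (map (eval_trm A \<sigma>) ts)"

definition satisfies :: "('f, 'a) alg \<Rightarrow> 'f trm \<times> 'f trm \<Rightarrow> bool" (infix "\<Turnstile>" 50) where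
  "A \<Turnstile> e \<longleftrightarrow> (\<forall>\<sigma>. range \<sigma> \<subseteq> carrier A \<longrightarrow> eval_trm A \<sigma> (fst e) = eval_trm A \<sigma> (snd e))"

definition variety :: "('f::signature, 'a) alg set \<Rightarrow> bool" where
  "variety V \<longleftrightarrow> (\<exists>E. (\<forall>(s, t)\<in>E. wf_trm s \<and> wf_trm t) \<and>
     V = {A. is_algebra A \<and> (\<forall>e\<in>E. A \<Turnstile> e)})"

definition variety_of :: "('f::signature, 'a) alg set \<Rightarrow> ('f, 'a) alg set \<Rightarrow> bool" where
  "variety_of K V \<longleftrightarrow> variety V \<and> V \<subseteq> K"

text \<open>
  The generating algebra may live on another type than the universe \<open>'a\<close>; the least variety is
  taken among those that contain its isomorphic copies in \<open>'a\<close>. The universe has to be large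
  enough for such copies to exist.
\<close>

definition generated_variety :: "('f::signature, 'b) alg \<Rightarrow> ('f, 'a) alg set" where
  "generated_variety B = \<Inter>{V. variety V \<and> {A. A \<cong> B} \<subseteq> V}"


section \<open>Monadic Heyting algebras, MS4-algebras and MGrz-algebras\<close>

locale bounded_lattice_on =
  fixes L :: "'a set"
    and meet :: "'a \<Rightarrow> 'a \<Rightarrow> 'a" (infixl "\<sqinter>" 70)
    and join :: "'a \<Rightarrow> 'a \<Rightarrow> 'a" (infixl "\<squnion>" 65)
    and zero :: 'a ("\<zero>")
    and one :: 'a ("\<one>")
  assumes meet_closed: "\<lbrakk>a \<in> L; b \<in> L\<rbrakk> \<Longrightarrow> a \<sqinter> b \<in> L"
    and join_closed: "\<lbrakk>a \<in> L; b \<in> L\<rbrakk> \<Longrightarrow> a \<squnion> b \<in> L"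
    and zero_closed: "\<zero> \<in> L"
    and one_closed: "\<one> \<in> L"
    and meet_commute: "\<lbrakk>a \<in> L; b \<in> L\<rbrakk> \<Longrightarrow> a \<sqinter> b = b \<sqinter> a"
    and join_commute: "\<lbrakk>a \<in> L; b \<in> L\<rbrakk> \<Longrightarrow> a \<squnion> b = b \<squnion> a"
    and meet_assoc: "\<lbrakk>a \<in> L; b \<in> L; c \<in> L\<rbrakk> \<Longrightarrow> (a \<sqinter> b) \<sqinter> c = a \<sqinter> (b \<sqinter> c)"
    and join_assoc: "\<lbrakk>a \<in> L; b \<in> L; c \<in> L\<rbrakk> \<Longrightarrow> (a \<squnion> b) \<squnion> c = a \<squnion> (b \<squnion> c)"
    and meet_join_absorb: "\<lbrakk>a \<in> L; b \<in> L\<rbrakk> \<Longrightarrow> a \<sqinter> (a \<squnion> b) = a"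
    and join_meet_absorb: "\<lbrakk>a \<in> L; b \<in> L\<rbrakk> \<Longrightarrow> a \<squnion> (a \<sqinter> b) = a"
    and join_zero: "a \<in> L \<Longrightarrow> a \<squnion> \<zero> = a"
    and meet_one: "a \<in> L \<Longrightarrow> a \<sqinter> \<one> = a"
begin

abbreviation le :: "'a \<Rightarrow> 'a \<Rightarrow> bool" (infix "\<preceq>" 50) where
  "a \<preceq> b \<equiv> a \<sqinter> b = a"

end

locale heyting_on = bounded_lattice_on +
  fixes imp :: "'a \<Rightarrow> 'a \<Rightarrow> 'a" (infixr "\<rightharpoonup>" 60)
  assumes imp_closed: "\<lbrakk>a \<in> L; b \<in> L\<rbrakk> \<Longrightarrow> a \<rightharpoonup> b \<in> L"
    and residuation: "\<lbrakk>a \<in> L; b \<in> L; c \<in> L\<rbrakk> \<Longrightarrow> a \<sqinter> c \<preceq> b \<longleftrightarrow> c \<preceq> a \<rightharpoonup> b"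

locale monadic_heyting_on = heyting_on +
  fixes univ ex :: "'a \<Rightarrow> 'a"
  assumes univ_closed: "a \<in> L \<Longrightarrow> univ a \<in> L"
    and ex_closed: "a \<in> L \<Longrightarrow> ex a \<in> L"
    and univ_meet: "\<lbrakk>a \<in> L; b \<in> L\<rbrakk> \<Longrightarrow> univ (a \<sqinter> b) = univ a \<sqinter> univ b"
    and univ_le: "a \<in> L \<Longrightarrow> univ a \<preceq> a"
    and univ_univ: "a \<in> L \<Longrightarrow> univ a \<preceq> univ (univ a)"
    and ex_join: "\<lbrakk>a \<in> L; b \<in> L\<rbrakk> \<Longrightarrow> ex (a \<squnion> b) = ex a \<squnion> ex b"
    and le_ex: "a \<in> L \<Longrightarrow> a \<preceq> ex a"
    and ex_ex: "a \<in> L \<Longrightarrow> ex (ex a) \<preceq> ex a"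
    and ex_meet_ex: "\<lbrakk>a \<in> L; b \<in> L\<rbrakk> \<Longrightarrow> ex a \<sqinter> ex b \<preceq> ex (ex a \<sqinter> b)"
    and ex_univ: "a \<in> L \<Longrightarrow> ex (univ a) = univ a"
    and univ_ex: "a \<in> L \<Longrightarrow> ex a = univ (ex a)"

locale boolean_on = bounded_lattice_on +
  fixes neg :: "'a \<Rightarrow> 'a"
  assumes neg_closed: "a \<in> L \<Longrightarrow> neg a \<in> L"
    and meet_join_distrib:
      "\<lbrakk>a \<in> L; b \<in> L; c \<in> L\<rbrakk> \<Longrightarrow> a \<sqinter> (b \<squnion> c) = (a \<sqinter> b) \<squnion> (a \<sqinter> c)"
    and meet_neg: "a \<in> L \<Longrightarrow> a \<sqinter> neg a = \<zero>"
    and join_neg: "a \<in> L \<Longrightarrow> a \<squnion> neg a = \<one>"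

locale S4_on = boolean_on +
  fixes nec :: "'a \<Rightarrow> 'a"
  assumes nec_closed: "a \<in> L \<Longrightarrow> nec a \<in> L"
    and nec_one: "nec \<one> = \<one>"
    and nec_meet: "\<lbrakk>a \<in> L; b \<in> L\<rbrakk> \<Longrightarrow> nec (a \<sqinter> b) = nec a \<sqinter> nec b"
    and nec_le: "a \<in> L \<Longrightarrow> nec a \<preceq> a"
    and nec_nec: "a \<in> L \<Longrightarrow> nec a \<preceq> nec (nec a)"

locale S5_on = S4_on +
  assumes neg_nec: "a \<in> L \<Longrightarrow> neg (nec a) \<preceq> nec (neg (nec a))"

locale MS4_on =
  S4_on L meet join zero one neg box + univ: S5_on L meet join zero one neg univ
  for L :: "'a set"
    and meet (infixl "\<sqinter>" 70) and join (infixl "\<squnion>" 65) and zero ("\<zero>") and one ("\<one>")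
    and neg box univ +
  assumes box_univ: "a \<in> L \<Longrightarrow> box (univ a) \<preceq> univ (box a)"

locale MGrz_on = MS4_on +
  assumes grz: "a \<in> L \<Longrightarrow> box (neg (box (neg a \<squnion> box a)) \<squnion> a) \<preceq> a"

datatype heyting_op = HZero | HOne | HMeet | HJoin | HImp | HForall | HExists

instantiation heyting_op :: signature
begin

fun arity_heyting_op :: "heyting_op \<Rightarrow> nat" where
  "arity_heyting_op HZero = 0"
| "arity_heyting_op HOne = 0"
| "arity_heyting_op HMeet = 2"
| "arity_heyting_op HJoin = 2"
| "arity_heyting_op HImp = 2"
| "arity_heyting_op HForall = 1"
| "arity_heyting_op HExists = 1"

instance ..

end

datatype modal_op = Zero | One | Meet | Join | Neg | Box | Forall

instantiation modal_op :: signature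
begin

fun arity_modal_op :: "modal_op \<Rightarrow> nat" where
  "arity_modal_op Zero = 0"
| "arity_modal_op One = 0"
| "arity_modal_op Meet = 2"
| "arity_modal_op Join = 2"
| "arity_modal_op Neg = 1"
| "arity_modal_op Box = 1"
| "arity_modal_op Forall = 1"

instance ..

end

definition monadic_heyting_algebras :: "(heyting_op, 'a) alg set" where
  "monadic_heyting_algebras =
     {A. monadic_heyting_on (carrier A)
           (\<lambda>a b. interp A HMeet [a, b]) (\<lambda>a b. interp A HJoin [a, b])
           (interp A HZero []) (interp A HOne []) (\<lambda>a b. interp A HImp [a, b])
           (\<lambda>a. interp A HForall [a]) (\<lambda>a. interp A HExists [a])}"

definition MS4_algebras :: "(modal_op, 'a) alg set" where
  "MS4_algebras =
     {B. MS4_on (carrier B)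
           (\<lambda>a b. interp B Meet [a, b]) (\<lambda>a b. interp B Join [a, b])
           (interp B Zero []) (interp B One []) (\<lambda>a. interp B Neg [a])
           (\<lambda>a. interp B Box [a]) (\<lambda>a. interp B Forall [a])}"

definition MGrz_algebras :: "(modal_op, 'a) alg set" where
  "MGrz_algebras =
     {B. MGrz_on (carrier B)
           (\<lambda>a b. interp B Meet [a, b]) (\<lambda>a b. interp B Join [a, b])
           (interp B Zero []) (interp B One []) (\<lambda>a. interp B Neg [a])
           (\<lambda>a. interp B Box [a]) (\<lambda>a. interp B Forall [a])}"


section \<open>The algebra of open elements\<close>

text \<open>Argument lists of the wrong length are irrelevant and left unspecified.\<close>

fun open_interp :: "(modal_op, 'a) alg \<Rightarrow> heyting_op \<Rightarrow> 'a list \<Rightarrow> 'a" where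
  "open_interp B HZero [] = interp B Zero []"
| "open_interp B HOne [] = interp B One []"
| "open_interp B HMeet [a, b] = interp B Meet [a, b]"
| "open_interp B HJoin [a, b] = interp B Join [a, b]"
| "open_interp B HImp [a, b] = interp B Box [interp B Join [interp B Neg [a], b]]"
| "open_interp B HForall [a] = interp B Box [interp B Forall [a]]"
| "open_interp B HExists [a] = interp B Neg [interp B Forall [interp B Neg [a]]]"

definition open_algebra :: "(modal_op, 'a) alg \<Rightarrow> (heyting_op, 'a) alg" where
  "open_algebra B =
     \<lparr>carrier = {a \<in> carrier B. interp B Box [a] = a}, interp = open_interp B\<rparr>"

definition open_algebras :: "(modal_op, 'a) alg set \<Rightarrow> (heyting_op, 'a) alg set" ("\<O>") where
  "\<O> K = {A. \<exists>B\<in>K. A \<cong> open_algebra B}"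


section \<open>The algebra of the frame $\mathfrak{K}_1$\<close>

fun complex_interp :: "'p set \<Rightarrow> 'p rel \<Rightarrow> 'p rel \<Rightarrow> modal_op \<Rightarrow> 'p set list \<Rightarrow> 'p set" where
  "complex_interp Y R E Zero [] = {}"
| "complex_interp Y R E One [] = Y"
| "complex_interp Y R E Meet [U, V] = U \<inter> V"
| "complex_interp Y R E Join [U, V] = U \<union> V"
| "complex_interp Y R E Neg [U] = Y - U"
| "complex_interp Y R E Box [U] = Y - R\<inverse> `` (Y - U)"
| "complex_interp Y R E Forall [U] = Y - E `` (Y - U)"

definition complex_algebra :: "'p set \<Rightarrow> 'p rel \<Rightarrow> 'p rel \<Rightarrow> (modal_op, 'p set) alg" where
  "complex_algebra Y R E = \<lparr>carrier = Pow Y, interp = complex_interp Y R E\<rparr>"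

datatype point = pt_u | pt_v | pt_w | pt_z

definition Y1 :: "point set" where
  "Y1 = {pt_u, pt_v, pt_w, pt_z}"

definition R1 :: "point rel" where
  "R1 = Id_on Y1 \<union>
     {(pt_u, pt_v), (pt_u, pt_w), (pt_u, pt_z), (pt_v, pt_z), (pt_w, pt_z)}"

definition E1 :: "point rel" where
  "E1 = {pt_u} \<times> {pt_u} \<union> {pt_w} \<times> {pt_w} \<union> {pt_v, pt_z} \<times> {pt_v, pt_z}"

definition B1 :: "(modal_op, point set) alg" where
  "B1 = complex_algebra Y1 R1 E1"

end

theory Submission
  imports Defs
begin

text \<open>
  Let \<open>B2\<close> be the algebra of the chain \<open>u < v < z\<close> with classes \<open>{u}\<close> and \<open>{v, z}\<close>. Collapsing
  \<open>w\<close> to \<open>z\<close> maps the frame of \<open>B1\<close> onto this chain. The map preserves and lifts \<open>R\<close>, but it does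
  not lift \<open>E\<close>, so \<open>B2\<close> is not a subalgebra of \<open>B1\<close> in this way; on upsets, however,
  inverse images commute with \<open>\<exists>\<close> and \<open>\<box>\<forall>\<close>, and therefore \<open>\<O>(B2)\<close> embeds into \<open>\<O>(B1)\<close>
  (\<open>preimage_hom\<close>).

  The two algebras are told apart by the term \<open>t = c \<and> \<exists>(\<exists>c \<and> \<not>c)\<close>, which no Heyting term expresses,
  applied to an open \<open>c\<close> with \<open>(\<exists>c \<rightarrow> c) = c\<close>. In \<open>B1\<close> such a \<open>c\<close> is \<open>{w, z}\<close> or everything, and \<open>t\<close> is
  \<open>{z}\<close> or empty. Hence in every algebra of the variety \<open>V1\<close> the element \<open>t\<close> is open, \<open>c \<rightarrow> t \<le> \<exists>c\<close>
  and \<open>\<exists>c \<le> c \<or> \<exists>t\<close> (\<open>trace_in_hull_B1\<close>). In \<open>\<O>(B2)\<close> no open \<open>t\<close> below \<open>c = {z}\<close> has these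
  properties: the first inequality fails for \<open>t = {z}\<close> and the second for \<open>t = {}\<close>. So \<open>\<O>(B2)\<close> lies in
  \<open>\<S>(\<O>(V1))\<close> but not in \<open>\<O>(V1)\<close>. Since varieties are closed under subalgebras, \<open>\<O>(V1)\<close> is not a
  variety, and \<open>\<S>\<close> and \<open>\<O>\<close> do not commute on \<open>V1\<close>.

  In the variety \<open>W\<close> generated by \<open>B2\<close> the same term satisfies \<open>t \<or> \<box>\<forall>c = c\<close>. An algebra in \<open>V1 \<inter> W\<close>
  whose open elements contain \<open>\<O>(B2)\<close> would have \<open>\<box>\<forall>c = 0\<close>, hence \<open>t = c\<close>, which \<open>V1\<close> forbids. So
  \<open>\<O>(B2)\<close> separates \<open>\<S>(\<O>(V1)) \<inter> \<S>(\<O>(W))\<close> from \<open>\<S>(\<O>(V1 \<inter> W))\<close>.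

  Finally let \<open>J\<close> be the variety generated by \<open>B1\<close> and \<open>B2\<close>. It differs from \<open>V1\<close>, because \<open>V1\<close> does
  not contain \<open>B2\<close>. By the Goedel translation of Heyting terms, the algebras in \<open>\<S>(\<O>(J))\<close> satisfy the
  identities common to \<open>\<O>(B1)\<close> and \<open>\<O>(B2)\<close>, that is, the identities of \<open>\<O>(B1)\<close>. Conversely, every
  algebra with the identities of \<open>\<O>(B1)\<close> embeds into the algebra of open elements of a member of \<open>V1\<close>
  (\<open>embeds_in_open_algebra_of_hull\<close>), so \<open>\<S>(\<O>(J)) = \<S>(\<O>(V1))\<close>.
\<close>

section \<open>Homomorphisms and identities\<close>

lemma is_algebraD:
  "is_algebra A \<Longrightarrow> length xs = arity f \<Longrightarrow> set xs \<subseteq> carrier A \<Longrightarrow> interp A f xs \<in> carrier A"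
  by (simp add: is_algebra_def)

lemma homD:
  assumes "h \<in> hom A B"
  shows "a \<in> carrier A \<Longrightarrow> h a \<in> carrier B"
    and "length xs = arity f \<Longrightarrow> set xs \<subseteq> carrier A \<Longrightarrow> h (interp A f xs) = interp B f (map h xs)"
  using assms by (auto simp: hom_def)

lemma eval_trm_closed:
  assumes "is_algebra A" and "range \<sigma> \<subseteq> carrier A"
  shows "wf_trm t \<Longrightarrow> eval_trm A \<sigma> t \<in> carrier A"
  by (induction t) (use assms in \<open>auto intro!: is_algebraD\<close>)

lemma hom_eval_trm:
  assumes "is_algebra A" and "h \<in> hom A B" and "range \<sigma> \<subseteq> carrier A"
  shows "wf_trm t \<Longrightarrow> h (eval_trm A \<sigma> t) = eval_trm B (h \<circ> \<sigma>) t"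
proof (induction t)
  case (App f ts)
  have "h (interp A f (map (eval_trm A \<sigma>) ts)) = interp B f (map h (map (eval_trm A \<sigma>) ts))"
    using App.prems eval_trm_closed[OF assms(1,3)] by (intro homD(2)[OF assms(2)]) auto
  also have "map h (map (eval_trm A \<sigma>) ts) = map (eval_trm B (h \<circ> \<sigma>)) ts"
    using App by (simp add: comp_def)
  finally show ?case by (simp only: eval_trm.simps)
qed simp

lemma satisfies_if_embeds:
  assumes "is_algebra A" and "h \<in> hom A B" and "inj_on h (carrier A)"
    and "wf_trm s" and "wf_trm t" and "B \<Turnstile> (s, t)"
  shows "A \<Turnstile> (s, t)"
  unfolding satisfies_def fst_conv snd_conv
proof (intro allI impI)
  fix \<sigma> :: "nat \<Rightarrow> _" assume \<sigma>: "range \<sigma> \<subseteq> carrier A"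
  then have "range (h \<circ> \<sigma>) \<subseteq> carrier B"
    using homD(1)[OF assms(2)] by auto
  then have "h (eval_trm A \<sigma> s) = h (eval_trm A \<sigma> t)"
    using assms \<sigma> by (simp add: hom_eval_trm satisfies_def)
  then show "eval_trm A \<sigma> s = eval_trm A \<sigma> t"
    using inj_onD[OF assms(3)] eval_trm_closed[OF assms(1) \<sigma>] assms(4,5) by blast
qed

lemma satisfies_if_image:
  assumes "is_algebra A" and "h \<in> hom A B" and "h ` carrier A = carrier B"
    and "wf_trm s" and "wf_trm t" and "A \<Turnstile> (s, t)"
  shows "B \<Turnstile> (s, t)"
  unfolding satisfies_def fst_conv snd_conv
proof (intro allI impI)
  fix \<sigma> :: "nat \<Rightarrow> _" assume \<sigma>: "range \<sigma> \<subseteq> carrier B"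
  define \<tau> where "\<tau> = inv_into (carrier A) h \<circ> \<sigma>"
  have \<tau>: "range \<tau> \<subseteq> carrier A" and "h \<circ> \<tau> = \<sigma>"
    using \<sigma> assms(3) by (auto simp: \<tau>_def fun_eq_iff inv_into_into f_inv_into_f subset_iff)
  then show "eval_trm B \<sigma> s = eval_trm B \<sigma> t"
    using hom_eval_trm[OF assms(1,2) \<tau>] assms(4-6) by (metis fst_conv satisfies_def snd_conv)
qed

lemma isomorphic_sym:
  assumes "A \<cong> B"
  shows "B \<cong> A"
proof -
  obtain h where alg: "is_algebra A" "is_algebra B" and h: "h \<in> hom A B"
    and bij: "bij_betw h (carrier A) (carrier B)"
    using assms by (auto simp: isomorphic_def)
  let ?g = "inv_into (carrier A) h"
  have gB: "?g b \<in> carrier A" "h (?g b) = b" if "b \<in> carrier B" for b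
    using that bij by (auto simp: bij_betw_def inv_into_into f_inv_into_f)
  have "?g (interp B f xs) = interp A f (map ?g xs)"
    if "length xs = arity f" "set xs \<subseteq> carrier B" for f xs
  proof -
    have xs: "set (map ?g xs) \<subseteq> carrier A" and "map (h \<circ> ?g) xs = xs"
      using that(2) gB by (auto intro!: map_idI)
    then have "h (interp A f (map ?g xs)) = interp B f xs"
      using homD(2)[OF h _ xs] that(1) by simp
    moreover have "interp A f (map ?g xs) \<in> carrier A"
      using is_algebraD[OF alg(1) _ xs] that(1) by simp
    ultimately show ?thesis
      using bij by (metis bij_betw_def inv_into_f_f)
  qed
  then have "?g \<in> hom B A"
    using gB by (auto simp: hom_def)
  then show ?thesis
    using alg bij_betw_inv_into[OF bij] by (auto simp: isomorphic_def)
qed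

lemma isomorphic_satisfies_iff:
  assumes "A \<cong> B" and "wf_trm s" and "wf_trm t"
  shows "A \<Turnstile> (s, t) \<longleftrightarrow> B \<Turnstile> (s, t)"
  using assms by (auto simp: isomorphic_def bij_betw_def intro: satisfies_if_embeds satisfies_if_image)

lemma hom_comp:
  assumes "g \<in> hom A B" and "h \<in> hom B C"
  shows "h \<circ> g \<in> hom A C"
proof -
  have "(h \<circ> g) (interp A f xs) = interp C f (map (h \<circ> g) xs)"
    if "length xs = arity f" and xs: "set xs \<subseteq> carrier A" for f xs
  proof -
    have "set (map g xs) \<subseteq> carrier B"
      using xs homD(1)[OF assms(1)] by auto
    then show ?thesis
      using that homD(2)[OF assms(1)] homD(2)[OF assms(2), of "map g xs" f] by simp
  qed
  then show ?thesis
    using homD(1)[OF assms(1)] homD(1)[OF assms(2)] by (auto simp: hom_def)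
qed

text \<open>
  Up to isomorphism a subalgebra is the same thing as the domain of an injective homomorphism; this
  is the form in which \<open>\<S>\<close> is used throughout.
\<close>

lemma in_subalgebras_iff:
  assumes "\<And>B. B \<in> K \<Longrightarrow> is_algebra B"
  shows "A \<in> \<S> K \<longleftrightarrow>
    is_algebra A \<and> (\<exists>B\<in>K. \<exists>h\<in>hom A B. inj_on h (carrier A))" (is "_ \<longleftrightarrow> ?R")
proof
  assume "A \<in> \<S> K"
  then obtain B C h where "B \<in> K" "is_algebra A" and C: "subalgebra C B" and h: "h \<in> hom A C"
    and bij: "bij_betw h (carrier A) (carrier C)"
    unfolding subalgebras_def isomorphic_def by blast
  have "h \<in> hom A B"
  proof -
    have "set (map h xs) \<subseteq> carrier C" if "set xs \<subseteq> carrier A" for xs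
      using that homD(1)[OF h] by auto
    then show ?thesis
      using h C by (auto simp: hom_def subalgebra_def)
  qed
  then show ?R
    using \<open>B \<in> K\<close> \<open>is_algebra A\<close> bij by (auto simp: bij_betw_def)
next
  assume ?R
  then obtain B h where A: "is_algebra A" and "B \<in> K" and h: "h \<in> hom A B"
    and inj: "inj_on h (carrier A)"
    by blast
  define C where "C = \<lparr>carrier = h ` carrier A, interp = interp B\<rparr>"
  have "interp B f ys \<in> h ` carrier A" if len: "length ys = arity f" and ys: "set ys \<subseteq> h ` carrier A" for f ys
  proof -
    from ys have "ys \<in> map h ` lists (carrier A)"
      by (simp add: in_lists_conv_set subset_iff flip: lists_image)
    then obtain xs where "set xs \<subseteq> carrier A" "ys = map h xs"
      by (auto simp: lists_eq_set)
    with len have "interp B f ys = h (interp A f xs)" and "interp A f xs \<in> carrier A"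
      using homD(2)[OF h, of xs f] is_algebraD[OF A, of xs f] by simp_all
    then show ?thesis
      by simp
  qed
  then have "subalgebra C B" and "is_algebra C"
    using homD(1)[OF h] by (auto simp: C_def subalgebra_def is_algebra_def)
  moreover have "A \<cong> C"
    using A h inj \<open>is_algebra C\<close>
    by (auto simp: isomorphic_def hom_def C_def bij_betw_def intro!: bexI[of _ h])
  ultimately show "A \<in> \<S> K"
    using \<open>B \<in> K\<close> by (auto simp: subalgebras_def)
qed

lemma variety_is_algebra: "variety V \<Longrightarrow> A \<in> V \<Longrightarrow> is_algebra A"
  by (auto simp: variety_def)

lemma subalgebras_variety:
  assumes "variety V"
  shows "\<S> V \<subseteq> V"
proof
  fix A assume "A \<in> \<S> V"
  then obtain B h where A: "is_algebra A" and "B \<in> V" and h: "h \<in> hom A B" "inj_on h (carrier A)"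
    using in_subalgebras_iff variety_is_algebra[OF assms] by metis
  obtain E where E: "\<forall>(s, t)\<in>E. wf_trm s \<and> wf_trm t" "V = {A. is_algebra A \<and> (\<forall>e\<in>E. A \<Turnstile> e)}"
    using assms by (auto simp: variety_def)
  have "A \<Turnstile> e" if "e \<in> E" for e
    using that satisfies_if_embeds[OF A h] E \<open>B \<in> V\<close> by (cases e) auto
  then show "A \<in> V"
    using A E(2) by simp
qed

text \<open>
  The members of the hull and the generating algebras may live on different types. This makes it
  possible to pass through intermediate algebras that are too large for the universe.
\<close>

definition equational_hull :: "('f::signature, 'b) alg set \<Rightarrow> ('f, 'a) alg set" where
  "equational_hull K = {A. is_algebra A \<and>
     (\<forall>s t. wf_trm s \<and> wf_trm t \<and> (\<forall>B\<in>K. B \<Turnstile> (s, t)) \<longrightarrow> A \<Turnstile> (s, t))}"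

lemma variety_equational_hull: "variety (equational_hull K)"
  unfolding variety_def equational_hull_def
  by (intro exI[of _ "{(s, t). wf_trm s \<and> wf_trm t \<and> (\<forall>B\<in>K. B \<Turnstile> (s, t))}"]) auto

lemma equational_hullI:
  assumes "A \<cong> B" and "B \<in> K"
  shows "A \<in> equational_hull K"
  using assms isomorphic_satisfies_iff[OF assms(1)] by (auto simp: equational_hull_def isomorphic_def)

lemma equational_hullD:
  assumes "A \<in> equational_hull K" and "wf_trm s" and "wf_trm t"
    and "\<And>B \<sigma>. B \<in> K \<Longrightarrow> range \<sigma> \<subseteq> carrier B \<Longrightarrow> eval_trm B \<sigma> s = eval_trm B \<sigma> t"
    and "range \<tau> \<subseteq> carrier A"
  shows "eval_trm A \<tau> s = eval_trm A \<tau> t"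
  using assms by (simp add: equational_hull_def satisfies_def)

lemma equational_hull_is_algebra: "A \<in> equational_hull K \<Longrightarrow> is_algebra A"
  by (simp add: equational_hull_def)

lemma equational_hull_mono: "K \<subseteq> L \<Longrightarrow> equational_hull K \<subseteq> equational_hull L"
  unfolding equational_hull_def by (simp add: subset_iff)

text \<open>
  A copy \<open>A\<close> of \<open>B\<close> in the universe transports identities back to \<open>B\<close>: if a variety contains \<open>A\<close>, its
  defining identities hold in \<open>B\<close>, hence in the hull of \<open>B\<close>.
\<close>

lemma generated_variety_eq_hull:
  fixes A :: "('f::signature, 'a) alg"
  assumes "A \<cong> B"
  shows "generated_variety B = (equational_hull {B} :: ('f, 'a) alg set)"
proof
  show "generated_variety B \<subseteq> (equational_hull {B} :: ('f, 'a) alg set)"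
    using variety_equational_hull equational_hullI unfolding generated_variety_def by blast
  show "(equational_hull {B} :: ('f, 'a) alg set) \<subseteq> generated_variety B"
    unfolding generated_variety_def
  proof (rule Inter_greatest, safe)
    fix V :: "('f, 'a) alg set" and C :: "('f, 'a) alg"
    assume "variety V" and copies: "{A. A \<cong> B} \<subseteq> V" and C: "C \<in> equational_hull {B}"
    then obtain E where E: "\<forall>(s, t)\<in>E. wf_trm s \<and> wf_trm t" "V = {A. is_algebra A \<and> (\<forall>e\<in>E. A \<Turnstile> e)}"
      by (auto simp: variety_def)
    have "C \<Turnstile> e" if "e \<in> E" for e
    proof (cases e)
      case (Pair s t)
      then have wf: "wf_trm s" "wf_trm t"
        using that E(1) by auto
      have "A \<in> V"
        using copies assms by blast
      then have "B \<Turnstile> (s, t)"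
        using isomorphic_satisfies_iff[OF assms wf] that E(2) Pair by blast
      then show ?thesis
        using C wf Pair by (simp add: equational_hull_def)
    qed
    then show "C \<in> V"
      using C E(2) by (simp add: equational_hull_def)
  qed
qed

lemma isomorphic_copy:
  fixes A :: "('f::signature, 'b) alg" and g :: "'b \<Rightarrow> 'a"
  assumes A: "is_algebra A" and inj: "inj_on g (carrier A)"
  shows "\<exists>B :: ('f, 'a) alg. B \<cong> A"
proof -
  let ?k = "inv_into (carrier A) g"
  define B where "B = \<lparr>carrier = g ` carrier A, interp = (\<lambda>f xs. g (interp A f (map ?k xs)))\<rparr>"
  have k: "?k x \<in> carrier A" if "x \<in> g ` carrier A" for x
    using that by (rule inv_into_into)
  have "is_algebra B"
    unfolding is_algebra_def B_def alg.simps
    by (intro allI impI imageI is_algebraD[OF A]) (auto simp: inj inv_into_f_f)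
  moreover have "g \<in> hom A B"
    unfolding hom_def B_def
    by (auto intro!: arg_cong[where f = g] arg_cong2[where f = "interp A"] sym[OF map_idI]
        simp: inj subset_iff)
  ultimately have "A \<cong> B"
    using A inj by (auto simp: isomorphic_def bij_betw_def B_def)
  then have "B \<cong> A"
    by (rule isomorphic_sym)
  then show ?thesis ..
qed

lemma isomorphic_copy_finite:
  fixes A :: "('f::signature, 'b) alg"
  assumes "is_algebra A" and "finite (carrier A)" and inf: "infinite (UNIV :: 'a set)"
  shows "\<exists>B :: ('f, 'a) alg. B \<cong> A"
proof -
  obtain X :: "'a set" where "finite X" "card X = card (carrier A)"
    using infinite_arbitrarily_large[OF inf] by blast
  then obtain g where "bij_betw g (carrier A) X"
    using assms(2) by (metis finite_same_card_bij)
  then show ?thesis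
    using isomorphic_copy[OF assms(1)] by (auto simp: bij_betw_def)
qed

section \<open>MGrz-algebras and monadic Heyting algebras as equational classes\<close>

abbreviation assign3 :: "'a \<Rightarrow> 'a \<Rightarrow> 'a \<Rightarrow> nat \<Rightarrow> 'a" where
  "assign3 a b c n \<equiv> (if n = 0 then a else if n = 1 then b else c)"

definition MGrz_identities :: "(modal_op trm \<times> modal_op trm) set" where
  "MGrz_identities =
    (let x = Var 0; y = Var 1; z = Var 2;
         meet = (\<lambda>s t. App Meet [s, t]); join = (\<lambda>s t. App Join [s, t]); neg = (\<lambda>t. App Neg [t]);
         box = (\<lambda>t. App Box [t]); univ = (\<lambda>t. App Forall [t]); zero = App Zero []; one = App One [];
         le = (\<lambda>s t. (meet s t, s))
     in {(meet x y, meet y x), (join x y, join y x),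
         (meet (meet x y) z, meet x (meet y z)), (join (join x y) z, join x (join y z)),
         (meet x (join x y), x), (join x (meet x y), x), (join x zero, x), (meet x one, x),
         (meet x (join y z), join (meet x y) (meet x z)), (meet x (neg x), zero), (join x (neg x), one),
         (box one, one), (box (meet x y), meet (box x) (box y)), le (box x) x, le (box x) (box (box x)),
         (univ one, one), (univ (meet x y), meet (univ x) (univ y)), le (univ x) x,
         le (univ x) (univ (univ x)), le (neg (univ x)) (univ (neg (univ x))),
         le (box (univ x)) (univ (box x)), le (box (join (neg (box (join (neg x) (box x)))) x)) x})"

lemma wf_MGrz_identities: "(s, t) \<in> MGrz_identities \<Longrightarrow> wf_trm s \<and> wf_trm t"
  by (auto simp: MGrz_identities_def Let_def)

lemma satisfies_MGrz_identities:
  assumes "A \<in> MGrz_algebras" and "e \<in> MGrz_identities"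
  shows "A \<Turnstile> e"
proof -
  interpret MGrz_on "carrier A" "\<lambda>a b. interp A Meet [a, b]" "\<lambda>a b. interp A Join [a, b]"
    "interp A Zero []" "interp A One []" "\<lambda>a. interp A Neg [a]" "\<lambda>a. interp A Box [a]"
    "\<lambda>a. interp A Forall [a]"
    using assms(1) by (simp add: MGrz_algebras_def)
  note rules = meet_commute join_commute meet_assoc join_assoc meet_join_absorb join_meet_absorb
    join_zero meet_one meet_join_distrib meet_neg join_neg nec_one nec_meet nec_le nec_nec
    univ.nec_one univ.nec_meet univ.nec_le univ.nec_nec univ.neg_nec box_univ grz
  show ?thesis
    using assms(2) unfolding MGrz_identities_def Let_def insert_iff empty_iff
    by ((elim disjE FalseE; hypsubst), unfold satisfies_def fst_conv snd_conv eval_trm.simps list.map)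
      ((intro allI impI, rule rules; blast)+)
qed

lemma MGrz_if_identities:
  assumes "is_algebra A" and "\<forall>e\<in>MGrz_identities. A \<Turnstile> e"
  shows "A \<in> MGrz_algebras"
proof -
  have zero: "interp A Zero [] \<in> carrier A"
    by (simp add: is_algebraD[OF assms(1)])
  then have [simp]: "carrier A \<noteq> {}"
    by blast
  have "eval_trm A (assign3 a b c) (fst e) = eval_trm A (assign3 a b c) (snd e)"
    if "a \<in> carrier A" "b \<in> carrier A" "c \<in> carrier A" "e \<in> MGrz_identities" for a b c e
    using that assms(2) by (auto simp: satisfies_def image_subset_iff)
  then have "\<forall>a\<in>carrier A. \<forall>b\<in>carrier A. \<forall>c\<in>carrier A. \<forall>e\<in>MGrz_identities.
      eval_trm A (assign3 a b c) (fst e) = eval_trm A (assign3 a b c) (snd e)"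
    by blast
  note eqs = this[unfolded MGrz_identities_def Let_def, simplified]
  note closed = is_algebraD[OF assms(1), of "[]"] is_algebraD[OF assms(1), of "[a]" for a]
    is_algebraD[OF assms(1), of "[a, b]" for a b]
  show ?thesis
    unfolding MGrz_algebras_def mem_Collect_eq
    by unfold_locales (use eqs zero in \<open>(simp add: closed; fail) | meson\<close>)+
qed

text \<open>
  Residuation is not an identity. It is replaced by \<open>x \<and> (x \<rightarrow> y) = x \<and> y\<close>, \<open>y \<le> x \<rightarrow> (x \<and> y)\<close> and
  \<open>x \<rightarrow> (y \<and> z) \<le> x \<rightarrow> z\<close>: the first gives one direction, the other two give the converse.
\<close>

definition monadic_heyting_identities :: "(heyting_op trm \<times> heyting_op trm) set" where
  "monadic_heyting_identities =
    (let x = Var 0; y = Var 1; z = Var 2;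
         meet = (\<lambda>s t. App HMeet [s, t]); join = (\<lambda>s t. App HJoin [s, t]);
         imp = (\<lambda>s t. App HImp [s, t]); univ = (\<lambda>t. App HForall [t]); ex = (\<lambda>t. App HExists [t]);
         zero = App HZero []; one = App HOne []; le = (\<lambda>s t. (meet s t, s))
     in {(meet x y, meet y x), (join x y, join y x),
         (meet (meet x y) z, meet x (meet y z)), (join (join x y) z, join x (join y z)),
         (meet x (join x y), x), (join x (meet x y), x), (join x zero, x), (meet x one, x),
         (meet x (imp x y), meet x y), le y (imp x (meet x y)), le (imp x (meet y z)) (imp x z),
         (univ (meet x y), meet (univ x) (univ y)), le (univ x) x, le (univ x) (univ (univ x)),
         (ex (join x y), join (ex x) (ex y)), le x (ex x), le (ex (ex x)) (ex x),
         le (meet (ex x) (ex y)) (ex (meet (ex x) y)),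
         (ex (univ x), univ x), (ex x, univ (ex x))})"

lemma wf_monadic_heyting_identities:
  "(s, t) \<in> monadic_heyting_identities \<Longrightarrow> wf_trm s \<and> wf_trm t"
  by (auto simp: monadic_heyting_identities_def Let_def)

lemma monadic_heyting_if_identities:
  assumes "is_algebra A" and "\<forall>e\<in>monadic_heyting_identities. A \<Turnstile> e"
  shows "A \<in> monadic_heyting_algebras"
proof -
  have zero: "interp A HZero [] \<in> carrier A"
    by (simp add: is_algebraD[OF assms(1)])
  then have [simp]: "carrier A \<noteq> {}"
    by blast
  have "eval_trm A (assign3 a b c) (fst e) = eval_trm A (assign3 a b c) (snd e)"
    if "a \<in> carrier A" "b \<in> carrier A" "c \<in> carrier A" "e \<in> monadic_heyting_identities" for a b c e
    using that assms(2) by (auto simp: satisfies_def image_subset_iff)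
  then have "\<forall>a\<in>carrier A. \<forall>b\<in>carrier A. \<forall>c\<in>carrier A. \<forall>e\<in>monadic_heyting_identities.
      eval_trm A (assign3 a b c) (fst e) = eval_trm A (assign3 a b c) (snd e)"
    by blast
  note eqs = this[unfolded monadic_heyting_identities_def Let_def, simplified]
  note closed = is_algebraD[OF assms(1), of "[]"] is_algebraD[OF assms(1), of "[a]" for a]
    is_algebraD[OF assms(1), of "[a, b]" for a b]
  interpret bounded_lattice_on "carrier A" "\<lambda>a b. interp A HMeet [a, b]" "\<lambda>a b. interp A HJoin [a, b]"
    "interp A HZero []" "interp A HOne []"
    by unfold_locales (use eqs zero in \<open>(simp add: closed; fail) | meson\<close>)+
  let ?meet = "\<lambda>a b. interp A HMeet [a, b]" and ?imp = "\<lambda>a b. interp A HImp [a, b]"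
  have imp_closed: "?imp a b \<in> carrier A" if "a \<in> carrier A" "b \<in> carrier A" for a b
    using that by (simp add: closed)
  have residuation: "?meet (?meet a c) b = ?meet a c \<longleftrightarrow> ?meet c (?imp a b) = c"
    if a: "a \<in> carrier A" and b: "b \<in> carrier A" and c: "c \<in> carrier A" for a b c
  proof
    have 1: "?meet c (?imp a (?meet a c)) = c"
      and 2: "?meet (?imp a (?meet (?meet a c) b)) (?imp a b) = ?imp a (?meet (?meet a c) b)"
      using eqs a b c meet_closed by blast+
    assume "?meet (?meet a c) b = ?meet a c"
    with 1 2 show "?meet c (?imp a b) = c"
      using meet_assoc a b c imp_closed meet_closed by metis
  next
    assume *: "?meet c (?imp a b) = c"
    have 1: "?meet a (?imp a b) = ?meet a b"
      using eqs a b by blast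
    have "?meet a c = ?meet a (?meet (?imp a b) c)"
      using * meet_commute c imp_closed[OF a b] by metis
    also have "\<dots> = ?meet (?meet a b) c"
      using 1 meet_assoc a c imp_closed[OF a b] by metis
    finally have "?meet a c = ?meet (?meet a c) b"
      using meet_assoc meet_commute a b c by metis
    then show "?meet (?meet a c) b = ?meet a c"
      by (rule sym)
  qed
  interpret heyting_on "carrier A" ?meet "\<lambda>a b. interp A HJoin [a, b]" "interp A HZero []"
    "interp A HOne []" ?imp
    by unfold_locales (use imp_closed residuation in \<open>simp; fail\<close>)+
  show ?thesis
    unfolding monadic_heyting_algebras_def mem_Collect_eq
    by unfold_locales (use eqs zero in \<open>(simp add: closed; fail) | meson\<close>)+
qed


section \<open>The translation of Heyting terms\<close>

text \<open>
  The Goedel translation: variables are boxed and the Heyting operations are replaced by the modal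
  terms that define them on open elements. An implication with a wrong number of arguments is sent to
  an arbitrary constant.
\<close>

fun open_trm :: "heyting_op trm \<Rightarrow> modal_op trm" where
  "open_trm (Var n) = App Box [Var n]"
| "open_trm (App HZero ts) = App Zero []"
| "open_trm (App HOne ts) = App One []"
| "open_trm (App HMeet ts) = App Meet (map open_trm ts)"
| "open_trm (App HJoin ts) = App Join (map open_trm ts)"
| "open_trm (App HImp [s, t]) = App Box [App Join [App Neg [open_trm s], open_trm t]]"
| "open_trm (App HImp ts) = App One []"
| "open_trm (App HForall ts) = App Box [App Forall (map open_trm ts)]"
| "open_trm (App HExists ts) = App Neg [App Forall [App Neg (map open_trm ts)]]"

lemma length_two_conv: "length xs = 2 \<longleftrightarrow> (\<exists>a b. xs = [a, b])"
  by (auto simp: numeral_2_eq_2 length_Suc_conv)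

lemma wf_open_trm: "wf_trm t \<Longrightarrow> wf_trm (open_trm t)"
  by (induction t rule: open_trm.induct) auto

lemma eval_open_trm:
  "wf_trm t \<Longrightarrow>
    eval_trm B \<sigma> (open_trm t) = eval_trm (open_algebra B) (\<lambda>n. interp B Box [\<sigma> n]) t"
  by (induction t rule: open_trm.induct)
    (auto simp: open_algebra_def length_two_conv length_Suc_conv)

lemma carrier_open_algebra:
  "carrier (open_algebra B) = {a \<in> carrier B. interp B Box [a] = a}"
  by (simp add: open_algebra_def)

lemma interp_open_algebra: "interp (open_algebra B) = open_interp B"
  by (simp add: open_algebra_def)

lemma open_algebra_satisfies:
  assumes "B \<Turnstile> (open_trm s, open_trm t)" and "wf_trm s" and "wf_trm t"
  shows "open_algebra B \<Turnstile> (s, t)"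
  unfolding satisfies_def fst_conv snd_conv
proof (intro allI impI)
  fix \<sigma> :: "nat \<Rightarrow> _" assume \<sigma>: "range \<sigma> \<subseteq> carrier (open_algebra B)"
  then have "(\<lambda>n. interp B Box [\<sigma> n]) = \<sigma>" and "range \<sigma> \<subseteq> carrier B"
    by (auto simp: carrier_open_algebra)
  then show "eval_trm (open_algebra B) \<sigma> s = eval_trm (open_algebra B) \<sigma> t"
    using assms by (auto simp: satisfies_def eval_open_trm dest!: spec[of _ \<sigma>])
qed

lemma satisfies_open_trm:
  assumes "open_algebra B \<Turnstile> (s, t)" and "wf_trm s" and "wf_trm t"
    and "\<And>a. a \<in> carrier B \<Longrightarrow> interp B Box [a] \<in> carrier (open_algebra B)"
  shows "B \<Turnstile> (open_trm s, open_trm t)"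
  using assms by (simp add: satisfies_def eval_open_trm image_subset_iff)

lemma open_algebra_hom:
  assumes "is_algebra A" and h: "h \<in> hom A B"
  shows "h \<in> hom (open_algebra A) (open_algebra B)"
proof -
  note closed = is_algebraD[OF assms(1), of "[]"] is_algebraD[OF assms(1), of "[a]" for a]
    is_algebraD[OF assms(1), of "[a, b]" for a b]
  note hs = homD(1)[OF h] homD(2)[OF h, of "[]"] homD(2)[OF h, of "[a]" for a]
    homD(2)[OF h, of "[a, b]" for a b]
  have "h (open_interp A f xs) = open_interp B f (map h xs)"
    if "length xs = arity f" "set xs \<subseteq> {a \<in> carrier A. interp A Box [a] = a}" for f xs
    using that by (cases f) (auto simp: length_two_conv length_Suc_conv closed hs)
  moreover have "h ` {a \<in> carrier A. interp A Box [a] = a} \<subseteq> {b \<in> carrier B. interp B Box [b] = b}"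
  proof safe
    fix a assume "a \<in> carrier A" "interp A Box [a] = a"
    then show "h a \<in> carrier B" "interp B Box [h a] = h a"
      using hs(1)[of a] homD(2)[OF h, of "[a]" Box] by simp_all
  qed
  ultimately show ?thesis
    by (simp add: hom_def open_algebra_def)
qed

text \<open>
  That the open elements are closed under a Heyting operation is expressed by an identity
  \<open>\<box>t = t\<close>, where \<open>t\<close> translates the operation applied to variables. So it passes from the generating
  algebras to the hull.
\<close>

lemma open_algebra_in_hull:
  assumes K: "\<And>M. M \<in> K \<Longrightarrow> is_algebra (open_algebra M) \<and> 
      (\<forall>a\<in>carrier M. interp M Box [a] \<in> carrier (open_algebra M))"
    and B: "B \<in> equational_hull K"
  shows "is_algebra (open_algebra B)"
  unfolding is_algebra_def
proof (intro allI impI, elim conjE)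
  fix f :: heyting_op and xs
  assume len: "length xs = arity f" and xs: "set xs \<subseteq> carrier (open_algebra B)"
  define t where "t = App f (map Var [0..<arity f])"
  define \<sigma> where "\<sigma> = (\<lambda>n. if n < arity f then xs ! n else interp B Zero [])"
  have alg: "is_algebra B"
    using B by (rule equational_hull_is_algebra)
  have \<sigma>: "range \<sigma> \<subseteq> carrier B"
    using xs len is_algebraD[OF alg, of "[]" Zero] by (auto simp: \<sigma>_def carrier_open_algebra subset_iff)
  have wf: "wf_trm t" "wf_trm (open_trm t)"
    by (auto simp: t_def intro!: wf_open_trm)
  have "interp B Box [xs ! n] = xs ! n" if "n < arity f" for n
    using that xs len by (auto simp: carrier_open_algebra subset_iff)
  then have "map (\<lambda>n. interp B Box [\<sigma> n]) [0..<arity f] = xs"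
    using len by (auto simp: \<sigma>_def intro!: nth_equalityI)
  then have val: "eval_trm B \<sigma> (open_trm t) = interp (open_algebra B) f xs"
    unfolding eval_open_trm[OF wf(1)] by (simp add: t_def comp_def)
  have "eval_trm B \<sigma> (App Box [open_trm t]) = eval_trm B \<sigma> (open_trm t)"
  proof (rule equational_hullD[OF B _ _ _ \<sigma>])
    fix M and \<tau> :: "nat \<Rightarrow> _" assume "M \<in> K" and \<tau>: "range \<tau> \<subseteq> carrier M"
    then have "range (\<lambda>n. interp M Box [\<tau> n]) \<subseteq> carrier (open_algebra M)"
      using K by auto
    then have "eval_trm M \<tau> (open_trm t) \<in> carrier (open_algebra M)"
      unfolding eval_open_trm[OF wf(1)] using K[OF \<open>M \<in> K\<close>] wf(1) by (intro eval_trm_closed) auto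
    then show "eval_trm M \<tau> (App Box [open_trm t]) = eval_trm M \<tau> (open_trm t)"
      by (simp add: carrier_open_algebra)
  qed (use wf in auto)
  then show "interp (open_algebra B) f xs \<in> carrier (open_algebra B)"
    using eval_trm_closed[OF alg \<sigma> wf(2)] by (simp add: val carrier_open_algebra)
qed

section \<open>Closure properties of equational hulls\<close>

lemma equational_hull_embeds:
  assumes "B \<in> equational_hull K" and "is_algebra A" and "h \<in> hom A B" and "inj_on h (carrier A)"
  shows "A \<in> equational_hull K"
  using assms satisfies_if_embeds[OF assms(2-4)] by (auto simp: equational_hull_def)

lemma equational_hull_image:
  assumes "A \<in> equational_hull K" and "is_algebra B" and "h \<in> hom A B" and "h ` carrier A = carrier B"
  shows "B \<in> equational_hull K"
  using assms satisfies_if_image[of A h B] by (auto simp: equational_hull_def)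

definition power_algebra :: "('f::signature, 'b) alg \<Rightarrow> ('f, 'i \<Rightarrow> 'b) alg" where
  "power_algebra M = \<lparr>carrier = {p. \<forall>i. p i \<in> carrier M},
     interp = (\<lambda>f ps i. interp M f (map (\<lambda>p. p i) ps))\<rparr>"

lemma power_algebra_in_hull:
  fixes M :: "('f::signature, 'b) alg"
  assumes "is_algebra M"
  shows "(power_algebra M :: ('f, 'i \<Rightarrow> 'b) alg) \<in> equational_hull {M}"
proof -
  let ?P = "power_algebra M :: ('f, 'i \<Rightarrow> 'b) alg"
  have eval: "eval_trm ?P \<sigma> t i = eval_trm M (\<lambda>n. \<sigma> n i) t" for \<sigma> t and i
    by (induction t) (simp_all add: power_algebra_def comp_def cong: map_cong)
  have "is_algebra ?P"
    unfolding is_algebra_def power_algebra_def alg.simps mem_Collect_eq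
    by (intro allI impI is_algebraD[OF assms]) auto
  moreover have "eval_trm ?P \<sigma> s = eval_trm ?P \<sigma> t"
    if st: "M \<Turnstile> (s, t)" and \<sigma>: "range \<sigma> \<subseteq> carrier ?P" for s t \<sigma>
  proof
    fix i
    have "range (\<lambda>n. \<sigma> n i) \<subseteq> carrier M"
      using \<sigma> by (auto simp: power_algebra_def)
    then show "eval_trm ?P \<sigma> s i = eval_trm ?P \<sigma> t i"
      using st by (simp add: satisfies_def eval)
  qed
  ultimately show ?thesis
    by (auto simp: equational_hull_def satisfies_def[of ?P])
qed

definition congruence :: "('f::signature, 'a) alg \<Rightarrow> 'a rel \<Rightarrow> bool" where
  "congruence A \<theta> \<longleftrightarrow> equiv (carrier A) \<theta> \<and>
     (\<forall>f xs ys. length xs = arity f \<and> list_all2 (\<lambda>x y. (x, y) \<in> \<theta>) xs ys \<longrightarrow>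
        (interp A f xs, interp A f ys) \<in> \<theta>)"

text \<open>
  An operation is evaluated at arbitrarily chosen members of the classes; for a congruence the choice
  does not matter.
\<close>

definition quotient_algebra :: "('f, 'a) alg \<Rightarrow> 'a rel \<Rightarrow> ('f, 'a set) alg" where
  "quotient_algebra A \<theta> = \<lparr>carrier = carrier A // \<theta>,
     interp = (\<lambda>f Xs. \<theta> `` {interp A f (map (\<lambda>X. SOME x. x \<in> X) Xs)})\<rparr>"

lemma quotient_algebra:
  assumes A: "is_algebra A" and \<theta>: "congruence A \<theta>"
  shows "is_algebra (quotient_algebra A \<theta>)"
    and "(\<lambda>x. \<theta> `` {x}) \<in> hom A (quotient_algebra A \<theta>)"
    and "(\<lambda>x. \<theta> `` {x}) ` carrier A = carrier (quotient_algebra A \<theta>)"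
proof -
  have equiv: "equiv (carrier A) \<theta>"
    using \<theta> by (simp add: congruence_def)
  let ?rep = "\<lambda>X. SOME x. x \<in> X"
  have rep: "?rep X \<in> X" if "X \<in> carrier A // \<theta>" for X
    using in_quotient_imp_non_empty[OF equiv that] by (simp add: some_in_eq)
  have "?rep X \<in> carrier A" if "X \<in> carrier A // \<theta>" for X
    using rep[OF that] in_quotient_imp_subset[OF equiv that] by blast
  then show "is_algebra (quotient_algebra A \<theta>)"
    unfolding is_algebra_def quotient_algebra_def alg.simps
    by (intro allI impI quotientI is_algebraD[OF A]) auto
  have "\<theta> `` {interp A f xs} = \<theta> `` {interp A f (map ?rep (map (\<lambda>x. \<theta> `` {x}) xs))}"
    if "length xs = arity f" and xs: "set xs \<subseteq> carrier A" for f xs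
  proof -
    have "(x, ?rep (\<theta> `` {x})) \<in> \<theta>" if "x \<in> set xs" for x
      using rep[OF quotientI[of x]] xs that by blast
    then have "list_all2 (\<lambda>x y. (x, y) \<in> \<theta>) xs (map ?rep (map (\<lambda>x. \<theta> `` {x}) xs))"
      by (simp add: list_all2_conv_all_nth)
    then have "(interp A f xs, interp A f (map ?rep (map (\<lambda>x. \<theta> `` {x}) xs))) \<in> \<theta>"
      using \<theta> that(1) by (simp add: congruence_def)
    then show ?thesis
      by (rule equiv_class_eq[OF equiv])
  qed
  then show "(\<lambda>x. \<theta> `` {x}) \<in> hom A (quotient_algebra A \<theta>)"
    by (auto simp: hom_def quotient_algebra_def intro: quotientI)
  show "(\<lambda>x. \<theta> `` {x}) ` carrier A = carrier (quotient_algebra A \<theta>)"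
    by (auto simp: quotient_algebra_def quotient_def)
qed

text \<open>
  A downward Loewenheim-Skolem argument: closing \<open>X\<close> under the operations takes countably many steps,
  and each step adds no more elements than there are finite argument lists and operations, which an
  infinite type absorbs.
\<close>

lemma small_subalgebra:
  includes cardinal_syntax
  fixes A :: "('f::signature, 'b) alg"
  assumes A: "is_algebra A" and X: "X \<subseteq> carrier A"
    and inf: "infinite (UNIV :: 'a set)"
    and ops: "|UNIV :: 'f set| \<le>o |UNIV :: 'a set|" and card_X: "|X| \<le>o |UNIV :: 'a set|"
  shows "\<exists>C. subalgebra C A \<and> X \<subseteq> carrier C \<and> |carrier C| \<le>o |UNIV :: 'a set|"
proof -
  define args where "args f Z = {xs. length xs = arity f \<and> set xs \<subseteq> Z}" for f :: 'f and Z :: "'b set"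
  define step where "step Z = Z \<union> (\<Union>f. interp A f ` args f Z)" for Z
  define G where "G n = (step ^^ n) X" for n
  have union: "|Y \<union> Z| \<le>o |UNIV :: 'a set|" and times: "|Z \<times> L| \<le>o |UNIV :: 'a set|"
    if "|Y| \<le>o |UNIV :: 'a set|" "|Z| \<le>o |UNIV :: 'a set|" "|L| \<le>o |UNIV :: 'a set|"
    for Y Z :: "'b set" and L :: "'b list set"
    using inf card_of_Un_ordLeq_infinite_Field[OF _ that(1,2) card_of_Card_order]
      card_of_Times_ordLeq_infinite_Field[OF _ that(2,3) card_of_Card_order]
    by (simp_all add: Field_card_of)
  have lists: "|{xs. length xs = n \<and> set xs \<subseteq> Z}| \<le>o |UNIV :: 'a set|"
    if "|Z| \<le>o |UNIV :: 'a set|" for n and Z :: "'b set"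
  proof (induction n)
    case 0
    have "{xs. length xs = 0 \<and> set xs \<subseteq> Z} = {[]}"
      by auto
    then show ?case
      by (simp add: card_of_singl_ordLeq)
  next
    case (Suc n)
    have "{xs. length xs = Suc n \<and> set xs \<subseteq> Z} =
        (\<lambda>(x, xs). x # xs) ` (Z \<times> {xs. length xs = n \<and> set xs \<subseteq> Z})"
      by (auto simp: length_Suc_conv)
    then show ?case
      using ordLeq_transitive[OF card_of_image times[OF that that Suc.IH]] by simp
  qed
  have "|G n| \<le>o |UNIV :: 'a set|" for n
  proof (induction n)
    case 0
    then show ?case
      using card_X by (simp add: G_def)
  next
    case (Suc n)
    have "|interp A f ` args f (G n)| \<le>o |UNIV :: 'a set|" for f
      unfolding args_def by (rule ordLeq_transitive[OF card_of_image lists[OF Suc.IH]])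
    then have "|\<Union>f. interp A f ` args f (G n)| \<le>o |UNIV :: 'a set|"
      by (intro card_of_UNION_ordLeq_infinite[OF inf ops]) auto
    then have "|step (G n)| \<le>o |UNIV :: 'a set|"
      unfolding step_def 
      using union[OF Suc.IH, of _ "{}"] by (simp add: card_of_empty)
    then show ?case
      by (simp add: G_def)
  qed
  then have card: "|\<Union>n. G n| \<le>o |UNIV :: 'a set|"
    by (intro card_of_UNION_ordLeq_infinite[OF inf]) (use inf in \<open>auto simp: infinite_iff_card_of_nat\<close>)
  have mono: "G m \<subseteq> G n" if "m \<le> n" for m n
    by (rule lift_Suc_mono_le[OF _ that]) (auto simp: G_def step_def)
  have G_sub: "G n \<subseteq> carrier A" for n
    by (induction n) (use X in \<open>auto simp: G_def step_def args_def intro!: is_algebraD[OF A]\<close>)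
  have closed: "interp A f xs \<in> (\<Union>n. G n)" if "length xs = arity f" "set xs \<subseteq> (\<Union>n. G n)" for f xs
  proof -
    have "\<exists>n. set xs \<subseteq> G n"
      using that(2)
    proof (induction xs)
      case (Cons x xs)
      then obtain m n where "x \<in> G m" "set xs \<subseteq> G n"
        by auto
      then have "set (x # xs) \<subseteq> G (max m n)"
        using mono[of m "max m n"] mono[of n "max m n"] by auto
      then show ?case ..
    qed simp
    then obtain n where "set xs \<subseteq> G n" ..
    then have "interp A f xs \<in> G (Suc n)"
      using that(1) by (auto simp: G_def step_def args_def)
    then show ?thesis
      by blast
  qed
  let ?C = "\<lparr>carrier = (\<Union>n. G n), interp = interp A\<rparr>"
  have "subalgebra ?C A"
    using closed UN_least[OF G_sub] by (simp add: subalgebra_def is_algebra_def)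
  moreover have "X \<subseteq> carrier ?C"
    by (auto simp: G_def intro!: exI[of _ 0])
  moreover have "|carrier ?C| \<le>o |UNIV :: 'a set|"
    using card by simp
  ultimately show ?thesis
    by blast
qed

fun rename_vars :: "(nat \<Rightarrow> nat) \<Rightarrow> 'f trm \<Rightarrow> 'f trm" where
  "rename_vars r (Var n) = Var (r n)"
| "rename_vars r (App f ts) = App f (map (rename_vars r) ts)"

lemma wf_rename_vars: "wf_trm t \<Longrightarrow> wf_trm (rename_vars r t)"
  by (induction t) auto

lemma eval_rename_vars: "eval_trm A \<sigma> (rename_vars r t) = eval_trm A (\<sigma> \<circ> r) t"
  by (induction t) (simp_all add: comp_def cong: map_cong)

lemma eval_trm_finite_support:
  fixes A :: "('f, 'a) alg"
  shows "\<exists>N. finite N \<and> (\<forall>\<sigma> \<tau>. (\<forall>n\<in>N. \<sigma> n = \<tau> n) \<longrightarrow> eval_trm A \<sigma> t = eval_trm A \<tau> t)"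
proof (induction t)
  case (Var n)
  show ?case
    by (intro exI[of _ "{n}"]) simp
next
  case (App f ts)
  then obtain N where N: "\<And>t. t \<in> set ts \<Longrightarrow> finite (N t)"
    "\<And>t \<sigma> \<tau>. t \<in> set ts \<Longrightarrow> \<forall>n\<in>N t. \<sigma> n = \<tau> n \<Longrightarrow> eval_trm A \<sigma> t = eval_trm A \<tau> t"
    by metis
  show ?case
  proof (intro exI[of _ "\<Union>t\<in>set ts. N t"] conjI allI impI)
    fix \<sigma> \<tau> :: "nat \<Rightarrow> 'a" assume "\<forall>n\<in>(\<Union>t\<in>set ts. N t). \<sigma> n = \<tau> n"
    then have "map (eval_trm A \<sigma>) ts = map (eval_trm A \<tau>) ts"
      by (intro map_cong[OF refl] N(2)) auto
    then show "eval_trm A \<sigma> (App f ts) = eval_trm A \<tau> (App f ts)"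
      by (simp only: eval_trm.simps)
  qed (use N(1) in auto)
qed

section \<open>Complex algebras of frames\<close>

text \<open>
  The assumption \<open>commute\<close> is the frame condition that corresponds to \<open>\<box>\<forall>a \<le> \<forall>\<box>a\<close>.
\<close>

locale MS4_frame =
  fixes Y :: "'p set" and R E :: "'p rel"
  assumes R_subset: "R \<subseteq> Y \<times> Y"
    and R_refl: "x \<in> Y \<Longrightarrow> (x, x) \<in> R"
    and R_trans: "\<lbrakk>(x, y) \<in> R; (y, z) \<in> R\<rbrakk> \<Longrightarrow> (x, z) \<in> R"
    and E_equiv: "equiv Y E"
    and commute: "\<lbrakk>(x, y) \<in> E; (y, z) \<in> R\<rbrakk> \<Longrightarrow> \<exists>w. (x, w) \<in> R \<and> (w, z) \<in> E"
begin

abbreviation cplx :: "(modal_op, 'p set) alg" where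
  "cplx \<equiv> complex_algebra Y R E"

lemma E_subset: "(x, y) \<in> E \<Longrightarrow> x \<in> Y \<and> y \<in> Y"
  and E_refl: "x \<in> Y \<Longrightarrow> (x, x) \<in> E"
  and E_sym: "(x, y) \<in> E \<Longrightarrow> (y, x) \<in> E"
  and E_trans: "\<lbrakk>(x, y) \<in> E; (y, z) \<in> E\<rbrakk> \<Longrightarrow> (x, z) \<in> E"
  using E_equiv by (auto simp: equiv_def refl_on_def dest: symD transD)

lemma R_Y: "(x, y) \<in> R \<Longrightarrow> x \<in> Y \<and> y \<in> Y"
  using R_subset by blast

lemma carrier_complex: "carrier cplx = Pow Y"
  by (simp add: complex_algebra_def)

lemma interp_complex: "interp cplx = complex_interp Y R E"
  by (simp add: complex_algebra_def)

lemma complex_is_algebra: "is_algebra cplx"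
  unfolding is_algebra_def carrier_complex interp_complex
proof (intro allI impI, elim conjE)
  fix f :: modal_op and xs :: "'p set list"
  assume "length xs = arity f" "set xs \<subseteq> Pow Y"
  then show "complex_interp Y R E f xs \<in> Pow Y"
    by (cases f) (auto simp: length_two_conv length_Suc_conv)
qed

lemma Box_set: "Y - R\<inverse> `` (Y - U) = {x \<in> Y. \<forall>y. (x, y) \<in> R \<longrightarrow> y \<in> U}"
  by (auto dest: R_Y)

lemma Forall_set: "Y - E `` (Y - U) = {x \<in> Y. \<forall>y. (x, y) \<in> E \<longrightarrow> y \<in> U}"
  by (auto dest: E_subset E_sym)

text \<open>
  For the Grzegorczyk axiom suppose that \<open>x\<close> satisfies \<open>\<box>(\<box>(U \<rightarrow> \<box>U) \<rightarrow> U)\<close> but lies outside \<open>U\<close>.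
  Above \<open>x\<close> there is a maximal point \<open>y\<close> outside \<open>U\<close>. It sees some \<open>z\<close> in \<open>U\<close> that sees a point outside
  \<open>U\<close>. By maximality the latter is \<open>y\<close>, and antisymmetry gives \<open>z = y\<close>.
\<close>

lemma complex_MGrz:
  assumes "finite Y" and antisym: "antisym R"
  shows "cplx \<in> MGrz_algebras"
proof -
  have "Y - R\<inverse> `` (Y - ((Y - (Y - R\<inverse> `` (Y - ((Y - U) \<union> (Y - R\<inverse> `` (Y - U)))))) \<union> U)) \<subseteq> U"
    (is "?G \<subseteq> U") if "U \<subseteq> Y" for U
  proof
    fix x assume x: "x \<in> ?G"
    show "x \<in> U"
    proof (rule ccontr)
      assume "x \<notin> U"
      define Z where "Z = {y \<in> Y - U. (x, y) \<in> R}"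
      have "finite Z" "x \<in> Z"
        using \<open>finite Y\<close> x \<open>x \<notin> U\<close> R_refl by (auto simp: Z_def)
      moreover have "wf (R\<inverse> \<inter> Z \<times> Z - Id)"
      proof (rule finite_acyclic_wf)
        show "finite (R\<inverse> \<inter> Z \<times> Z - Id)"
          using \<open>finite Z\<close> by simp
        have "R\<inverse> \<inter> Z \<times> Z - Id \<subseteq> (R - Id)\<inverse>"
          by blast
        moreover have "trans (R - Id)" "irrefl (R - Id)"
          using antisym R_trans by (auto simp: trans_def antisym_def irrefl_def)
        then have "acyclic ((R - Id)\<inverse>)"
          by (simp add: acyclic_converse acyclic_irrefl)
        ultimately show "acyclic (R\<inverse> \<inter> Z \<times> Z - Id)"
          using acyclic_subset by blast
      qed
      ultimately obtain y where y: "y \<in> Z" and max: "\<And>z. (z, y) \<in> R\<inverse> \<inter> Z \<times> Z - Id \<Longrightarrow> z \<notin> Z"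
        by (metis wfE_min)
      then have "y \<in> Y" "y \<notin> U" "(x, y) \<in> R"
        by (auto simp: Z_def)
      then obtain z where z: "(y, z) \<in> R" "z \<in> U" "z \<in> R\<inverse> `` (Y - U)"
        using x by blast
      then obtain w where w: "(z, w) \<in> R" "w \<in> Y - U"
        by blast
      have "(y, w) \<in> R"
        using R_trans z(1) w(1) by blast
      moreover have "w \<in> Z"
        using R_trans[OF \<open>(x, y) \<in> R\<close> \<open>(y, w) \<in> R\<close>] w(2) by (simp add: Z_def)
      ultimately have "w = y"
        using max[of w] y by blast
      then show False
        using w z \<open>y \<notin> U\<close> antisym by (metis antisymD)
    qed
  qed
  note grz = Int_absorb2[OF this]
  show ?thesis
    unfolding MGrz_algebras_def mem_Collect_eq carrier_complex interp_complex complex_interp.simps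
    apply unfold_locales
    apply (simp_all only: Pow_iff grz)
    unfolding Box_set Forall_set
    apply (auto; fail)+
    apply (auto dest: R_Y E_subset intro: R_refl E_refl; fail)+
    apply (auto intro: R_trans; fail)
    apply (auto dest: R_Y E_subset intro: R_refl E_refl; fail)+
    apply (auto intro: E_trans; fail)
    apply (auto dest: E_subset, meson E_trans E_sym)[1]
    apply (auto dest: commute E_subset)
    done
qed

definition "upsets = {U. U \<subseteq> Y \<and> R `` U \<subseteq> U}"

lemma carrier_open_complex: "carrier (open_algebra cplx) = upsets"
  using R_refl
  by (auto simp: carrier_open_algebra carrier_complex interp_complex Box_set upsets_def dest: R_Y)

lemma interp_open_complex:
  "interp (open_algebra cplx) HZero [] = {}"
  "interp (open_algebra cplx) HOne [] = Y"
  "interp (open_algebra cplx) HMeet [U, V] = U \<inter> V"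
  "interp (open_algebra cplx) HJoin [U, V] = U \<union> V"
  "interp (open_algebra cplx) HImp [U, V] = {x \<in> Y. \<forall>y. (x, y) \<in> R \<and> y \<in> U \<longrightarrow> y \<in> V}"
  "interp (open_algebra cplx) HForall [U] =
     {x \<in> Y. \<forall>y z. (x, y) \<in> R \<and> (y, z) \<in> E \<longrightarrow> z \<in> U}"
  "interp (open_algebra cplx) HExists [U] = E `` U"
  unfolding interp_open_algebra interp_complex open_interp.simps complex_interp.simps Box_set Forall_set
  by (auto dest: R_Y E_subset E_sym)

lemma upsets_closed:
  "{} \<in> upsets" "Y \<in> upsets" 
  "U \<in> upsets \<Longrightarrow> V \<in> upsets \<Longrightarrow> U \<inter> V \<in> upsets"
  "U \<in> upsets \<Longrightarrow> V \<in> upsets \<Longrightarrow> U \<union> V \<in> upsets"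
  "{x \<in> Y. \<forall>y. (x, y) \<in> R \<and> y \<in> U \<longrightarrow> y \<in> V} \<in> upsets"
  "{x \<in> Y. \<forall>y z. (x, y) \<in> R \<and> (y, z) \<in> E \<longrightarrow> z \<in> U} \<in> upsets"
  "U \<in> upsets \<Longrightarrow> E `` U \<in> upsets"
proof -
  show "E `` U \<in> upsets" if "U \<in> upsets"
    unfolding upsets_def
  proof safe
    fix x y z assume "x \<in> U" "(x, y) \<in> E" "(y, z) \<in> R"
    then obtain w where "(x, w) \<in> R" "(w, z) \<in> E"
      using commute by blast
    then show "z \<in> E `` U"
      using that \<open>x \<in> U\<close> by (auto simp: upsets_def)
  qed (auto dest: E_subset)
qed (auto simp: upsets_def dest: R_Y intro: R_trans)

lemma open_complex_is_algebra: "is_algebra (open_algebra cplx)"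
  unfolding is_algebra_def carrier_open_complex
proof (intro allI impI, elim conjE)
  fix f :: heyting_op and xs :: "'p set list"
  assume "length xs = arity f" "set xs \<subseteq> upsets"
  then show "interp (open_algebra cplx) f xs \<in> upsets"
    by (cases f) (auto simp: length_two_conv length_Suc_conv interp_open_complex upsets_closed)
qed

lemma Box_complex_open:
  assumes "U \<in> carrier cplx"
  shows "interp cplx Box [U] \<in> carrier (open_algebra cplx)"
  by (auto simp: carrier_open_complex upsets_def interp_complex Box_set dest: R_Y intro: R_trans)

text \<open>
  The composition of \<open>R\<close> and \<open>E\<close>, which is the accessibility relation of \<open>\<box>\<forall>\<close>, is transitive.
\<close>

lemma R_E_R_E:
  assumes "(x, y) \<in> R" "(y, z) \<in> E" "(z, a) \<in> R" "(a, b) \<in> E"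
  shows "\<exists>w. (x, w) \<in> R \<and> (w, b) \<in> E"
proof -
  obtain w where "(y, w) \<in> R" "(w, a) \<in> E"
    using commute assms(2,3) by blast
  then show ?thesis
    using R_trans[OF assms(1)] E_trans[OF _ assms(4)] by blast
qed

lemma open_complex_monadic_heyting:
  assumes "e \<in> monadic_heyting_identities"
  shows "open_algebra cplx \<Turnstile> e"
proof -
  have "\<forall>e\<in>monadic_heyting_identities.
      eval_trm (open_algebra cplx) \<sigma> (fst e) = eval_trm (open_algebra cplx) \<sigma> (snd e)"
    if \<sigma>: "\<And>n. \<sigma> n \<in> upsets" for \<sigma>
  proof -
    have sub: "x \<in> Y" and up: "(x, y) \<in> R \<Longrightarrow> y \<in> \<sigma> n" if "x \<in> \<sigma> n" for n x y
      using \<sigma>[of n] that by (auto simp: upsets_def)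
    let ?all = "\<lambda>U. {x \<in> Y. \<forall>y z. (x, y) \<in> R \<and> (y, z) \<in> E \<longrightarrow> z \<in> U}"
    have E_all: "E `` ?all U = ?all U" for U
    proof (intro equalityI subsetI)
      fix y assume "y \<in> E `` ?all U"
      then obtain x where x: "x \<in> ?all U" "(x, y) \<in> E"
        by blast
      then have "z \<in> U" if "(y, w) \<in> R" "(w, z) \<in> E" for w z
        using R_E_R_E[OF R_refl x(2) that] E_subset[OF x(2)] by blast
      then show "y \<in> ?all U"
        using x(2) E_subset by blast
    qed (use E_refl in blast)
    have all_E: "E `` \<sigma> n = ?all (E `` \<sigma> n)" for n
    proof (intro equalityI subsetI)
      fix y assume "y \<in> E `` \<sigma> n"
      then obtain x where x: "x \<in> \<sigma> n" "(x, y) \<in> E"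
        by blast
      have "z \<in> E `` \<sigma> n" if "(y, w) \<in> R" "(w, z) \<in> E" for w z
        using R_E_R_E[OF R_refl[OF sub[OF x(1)]] x(2) that] up[OF x(1)] by blast
      then show "y \<in> ?all (E `` \<sigma> n)"
        using x(2) E_subset by blast
    qed (use E_refl R_refl in blast)
    show ?thesis
      unfolding monadic_heyting_identities_def Let_def ball_simps fst_conv snd_conv eval_trm.simps
        list.map interp_open_complex
      apply (intro conjI TrueI)
      apply (auto dest: R_Y E_subset intro: R_refl E_refl sub; fail)+
      apply (auto dest: R_Y E_subset intro: R_refl E_refl sub up; fail)+
      apply (auto dest: R_Y E_subset intro: R_refl E_refl sub up, (meson R_E_R_E R_Y)+)[1]
      apply (auto dest: R_Y E_subset intro: R_refl E_refl sub up; fail)+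
      apply (auto dest: E_trans; fail)
      apply (auto dest: E_sym E_trans; fail)
      apply (rule E_all)
      apply (rule all_E)
      done
  qed
  then show ?thesis
    using assms by (auto simp: satisfies_def carrier_open_complex image_subset_iff)
qed

end

section \<open>Embedding into algebras of open elements\<close>

text \<open>
  Let \<open>A\<close> satisfy the identities of the algebra of open elements of a complex algebra \<open>M\<close>. The aim is
  to embed \<open>A\<close> into the open elements of an algebra in the hull of \<open>M\<close>. Start from the power of \<open>M\<close>
  over all valuations of the elements of \<open>A\<close> by upsets, in which \<open>a \<in> A\<close> is represented by the
  evaluation \<open>v \<mapsto> v a\<close>. The evaluations do not yet satisfy the relations of \<open>A\<close>. This is repaired by a
  congruence: two functions are identified if they agree, for every valuation, on the region where
  some condition \<open>t = 1\<close> that is true in \<open>A\<close> holds throughout. Such a region is closed under \<open>R\<close> and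
  \<open>E\<close>, and therefore the operations of \<open>M\<close> can be computed inside it.
\<close>

context MS4_frame
begin

context
  fixes A :: "(heyting_op, 'a) alg"
  assumes A: "is_algebra A"
    and identities: "\<And>s t. wf_trm s \<Longrightarrow> wf_trm t \<Longrightarrow> open_algebra cplx \<Turnstile> (s, t) \<Longrightarrow> A \<Turnstile> (s, t)"
begin

lemma identity_transfer:
  assumes "wf_trm s" and "wf_trm t" and "range \<tau> \<subseteq> carrier A"
    and "\<And>\<sigma>. range \<sigma> \<subseteq> upsets \<Longrightarrow>
      eval_trm (open_algebra cplx) \<sigma> s = eval_trm (open_algebra cplx) \<sigma> t"
  shows "eval_trm A \<tau> s = eval_trm A \<tau> t"
  using identities[of s t] assms by (simp add: satisfies_def carrier_open_complex)

definition valuations :: "('a \<Rightarrow> 'p set) set" where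
  "valuations = {v. range v \<subseteq> upsets}"

text \<open>
  A condition is a term whose variables are assigned elements of \<open>A\<close> and whose value in \<open>A\<close> is the
  top element.
\<close>

definition condition :: "heyting_op trm \<Rightarrow> (nat \<Rightarrow> 'a) \<Rightarrow> bool" where
  "condition t h \<longleftrightarrow> wf_trm t \<and> range h \<subseteq> carrier A \<and> eval_trm A h t = interp A HOne []"

definition region :: "heyting_op trm \<Rightarrow> (nat \<Rightarrow> 'a) \<Rightarrow> ('a \<Rightarrow> 'p set) \<Rightarrow> 'p set" where
  "region t h v = eval_trm (open_algebra cplx) (v \<circ> h) (App HForall [t])"

lemma region_eq:
  "region t h v =
    {x \<in> Y. \<forall>y z. (x, y) \<in> R \<and> (y, z) \<in> E \<longrightarrow> z \<in> eval_trm (open_algebra cplx) (v \<circ> h) t}"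
  by (simp add: region_def interp_open_complex)

lemma region_closed:
  shows "region t h v \<subseteq> Y"
    and "x \<in> region t h v \<Longrightarrow> (x, y) \<in> R \<Longrightarrow> y \<in> region t h v"
    and "x \<in> region t h v \<Longrightarrow> (x, y) \<in> E \<Longrightarrow> y \<in> region t h v"
proof -
  let ?U = "eval_trm (open_algebra cplx) (v \<circ> h) t"
  have "z \<in> ?U" if "x \<in> region t h v" "(x, y) \<in> R" "(y, w) \<in> R" "(w, z) \<in> E" for w z
    using that(1) R_trans[OF that(2,3)] that(4) unfolding region_eq by blast
  then show "x \<in> region t h v \<Longrightarrow> (x, y) \<in> R \<Longrightarrow> y \<in> region t h v"
    using R_Y unfolding region_eq by blast
  have "z \<in> ?U" if "x \<in> region t h v" "(x, y) \<in> E" "(y, w) \<in> R" "(w, z) \<in> E" for w z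
    using that(1) R_E_R_E[OF R_refl that(2-4)] unfolding region_eq by blast
  then show "x \<in> region t h v \<Longrightarrow> (x, y) \<in> E \<Longrightarrow> y \<in> region t h v"
    using E_subset unfolding region_eq by blast
qed (auto simp: region_eq)

lemma region_subset: "region t h v \<subseteq> eval_trm (open_algebra cplx) (v \<circ> h) t"
  unfolding region_eq using R_refl E_refl by blast

text \<open>
  Take the conjunction of two conditions, with even variables for the first one and odd variables
  for the second one.
\<close>

lemma condition_directed:
  assumes "condition s g" and "condition t h"
  shows "\<exists>u k. condition u k \<and> (\<forall>v. region u k v \<subseteq> region s g v \<inter> region t h v)"
proof -
  define u where "u = App HMeet [rename_vars (\<lambda>n. 2 * n) s, rename_vars (\<lambda>n. 2 * n + 1) t]"
  define k where "k n = (if even n then g (n div 2) else h (n div 2))" for n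
  have k: "k \<circ> (\<lambda>n. 2 * n) = g" "k \<circ> (\<lambda>n. 2 * n + 1) = h" "range k \<subseteq> carrier A"
    using assms by (auto simp: k_def fun_eq_iff condition_def)
  have "eval_trm A k u = interp A HMeet [interp A HOne [], interp A HOne []]"
    using assms k by (simp add: u_def eval_rename_vars condition_def)
  also have "\<dots> = interp A HOne []"
    using identity_transfer[of "App HMeet [App HOne [], App HOne []]" "App HOne []" k] k(3)
    by (simp add: interp_open_complex)
  finally have "condition u k"
    using assms k(3) by (simp add: condition_def u_def wf_rename_vars)
  moreover have "v \<circ> k \<circ> (\<lambda>n. 2 * n) = v \<circ> g" "v \<circ> k \<circ> (\<lambda>n. 2 * n + 1) = v \<circ> h" for v :: "'a \<Rightarrow> 'p set"
    using k by (simp_all only: comp_assoc)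
  then have "region u k v \<subseteq> region s g v \<inter> region t h v" for v
    by (auto simp: region_eq u_def interp_open_complex eval_rename_vars)
  ultimately show ?thesis
    by blast
qed

lemma condition_HOne: "\<exists>t h. condition t h"
proof -
  have "interp A HZero [] \<in> carrier A"
    by (simp add: is_algebraD[OF A])
  then have "condition (App HOne []) (\<lambda>_. interp A HZero [])"
    by (auto simp: condition_def)
  then show ?thesis
    by blast
qed

definition agree :: "(('a \<Rightarrow> 'p set) \<Rightarrow> 'p set) rel" where
  "agree = {(p, q). (\<forall>v. p v \<subseteq> Y \<and> q v \<subseteq> Y) \<and>
     (\<exists>t h. condition t h \<and> (\<forall>v\<in>valuations. p v \<inter> region t h v = q v \<inter> region t h v))}"

lemma agree_carrier:
  "(p, q) \<in> agree \<Longrightarrow> p \<in> carrier (power_algebra cplx) \<and> q \<in> carrier (power_algebra cplx)"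
  by (auto simp: agree_def power_algebra_def carrier_complex)

lemma agree_list:
  assumes "list_all2 (\<lambda>p q. (p, q) \<in> agree) ps qs"
  shows "\<exists>t h. condition t h \<and>
    (\<forall>v\<in>valuations. list_all2 (\<lambda>p q. p v \<inter> region t h v = q v \<inter> region t h v) ps qs)"
  using assms
proof (induction rule: list_all2_induct)
  case Nil
  then show ?case
    using condition_HOne by simp
next
  case (Cons p ps q qs)
  then obtain s g t h where "condition s g" "condition t h"
    and sg: "\<And>v. v \<in> valuations \<Longrightarrow> p v \<inter> region s g v = q v \<inter> region s g v"
    and th: "\<And>v. v \<in> valuations \<Longrightarrow>
      list_all2 (\<lambda>p q. p v \<inter> region t h v = q v \<inter> region t h v) ps qs"
    by (auto simp: agree_def)
  obtain u k where "condition u k" and uk: "\<And>v. region u k v \<subseteq> region s g v \<inter> region t h v"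
    using condition_directed[OF \<open>condition s g\<close> \<open>condition t h\<close>] by blast
  have "list_all2 (\<lambda>p q. p v \<inter> region u k v = q v \<inter> region u k v) (p # ps) (q # qs)"
    if "v \<in> valuations" for v
  proof -
    have "p v \<inter> region u k v = q v \<inter> region u k v"
      using sg[OF that] uk[of v] by blast
    moreover have "list_all2 (\<lambda>p q. p v \<inter> region u k v = q v \<inter> region u k v) ps qs"
      by (rule list_all2_mono[OF th[OF that]]) (use uk[of v] in blast)
    ultimately show ?thesis
      by simp
  qed
  then show ?case
    using \<open>condition u k\<close> by blast
qed

text \<open>
  Whether a point of \<open>D\<close> lies in \<open>\<box>U\<close> or \<open>\<forall>U\<close> depends only on its \<open>R\<close>- and \<open>E\<close>-successors, and these lie
  in \<open>D\<close> again.
\<close>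

lemma complex_interp_restrict:
  assumes D: "\<And>x y. x \<in> D \<Longrightarrow> (x, y) \<in> R \<Longrightarrow> y \<in> D" "\<And>x y. x \<in> D \<Longrightarrow> (x, y) \<in> E \<Longrightarrow> y \<in> D"
    and "length Us = arity f" and "list_all2 (\<lambda>U V. U \<inter> D = V \<inter> D) Us Vs"
  shows "complex_interp Y R E f Us \<inter> D = complex_interp Y R E f Vs \<inter> D"
proof (cases f)
  case Meet
  then obtain U U' V V' where "Us = [U, U']" "Vs = [V, V']" "U \<inter> D = V \<inter> D" "U' \<inter> D = V' \<inter> D"
    using assms(3,4) by (auto simp: length_two_conv list_all2_Cons1)
  then show ?thesis
    using Meet by simp blast
next
  case Join
  then obtain U U' V V' where "Us = [U, U']" "Vs = [V, V']" "U \<inter> D = V \<inter> D" "U' \<inter> D = V' \<inter> D"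
    using assms(3,4) by (auto simp: length_two_conv list_all2_Cons1)
  then show ?thesis
    using Join by simp blast
next
  case Neg
  then obtain U V where "Us = [U]" "Vs = [V]" and UV: "U \<inter> D = V \<inter> D"
    using assms(3,4) by (auto simp: length_Suc_conv list_all2_Cons1)
  have "complex_interp Y R E f [U] \<inter> D = complex_interp Y R E f [V] \<inter> D"
    unfolding Neg complex_interp.simps using UV by blast
  then show ?thesis
    by (simp only: \<open>Us = [U]\<close> \<open>Vs = [V]\<close>)
next
  case Box
  then obtain U V where "Us = [U]" "Vs = [V]" and UV: "U \<inter> D = V \<inter> D"
    using assms(3,4) by (auto simp: length_Suc_conv list_all2_Cons1)
  have "complex_interp Y R E f [U] \<inter> D = complex_interp Y R E f [V] \<inter> D"
    unfolding Box complex_interp.simps Box_set using UV D(1) by blast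
  then show ?thesis
    by (simp only: \<open>Us = [U]\<close> \<open>Vs = [V]\<close>)
next
  case Forall
  then obtain U V where "Us = [U]" "Vs = [V]" and UV: "U \<inter> D = V \<inter> D"
    using assms(3,4) by (auto simp: length_Suc_conv list_all2_Cons1)
  have "complex_interp Y R E f [U] \<inter> D = complex_interp Y R E f [V] \<inter> D"
    unfolding Forall complex_interp.simps Forall_set using UV D(2) by blast
  then show ?thesis
    by (simp only: \<open>Us = [U]\<close> \<open>Vs = [V]\<close>)
qed (use assms(3,4) in simp_all)

lemma congruence_agree: "congruence (power_algebra cplx) agree"
  unfolding congruence_def
proof (intro conjI allI impI; (elim conjE)?)
  show "equiv (carrier (power_algebra cplx)) agree"
  proof (rule equivI)
    show "agree \<subseteq> carrier (power_algebra cplx) \<times> carrier (power_algebra cplx)"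
      by (auto dest: agree_carrier)
    show "refl_on (carrier (power_algebra cplx)) agree"
      using condition_HOne by (auto simp: refl_on_def agree_def power_algebra_def carrier_complex)
    show "sym agree"
      by (auto simp: sym_def agree_def) metis
    show "trans agree"
    proof (rule transI)
      fix p q r assume pq: "(p, q) \<in> agree" and qr: "(q, r) \<in> agree"
      then obtain s g t h where st: "condition s g" "condition t h"
        "\<forall>v\<in>valuations. p v \<inter> region s g v = q v \<inter> region s g v"
        "\<forall>v\<in>valuations. q v \<inter> region t h v = r v \<inter> region t h v"
        by (auto simp: agree_def)
      obtain u k where "condition u k" and uk: "\<forall>v. region u k v \<subseteq> region s g v \<inter> region t h v"
        using condition_directed[OF st(1,2)] by blast
      moreover have "p v \<inter> region u k v = r v \<inter> region u k v" if "v \<in> valuations" for v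
        using that st(3,4) uk by blast
      ultimately show "(p, r) \<in> agree"
        using pq qr unfolding agree_def by blast
    qed
  qed
next
  fix f :: modal_op and ps qs :: "(('a \<Rightarrow> 'p set) \<Rightarrow> 'p set) list"
  assume len: "length ps = arity f" and pq: "list_all2 (\<lambda>p q. (p, q) \<in> agree) ps qs"
  then obtain t h where cond: "condition t h"
    and th: "\<And>v. v \<in> valuations \<Longrightarrow> list_all2 (\<lambda>p q. p v \<inter> region t h v = q v \<inter> region t h v) ps qs"
    using agree_list by blast
  have "interp cplx f (map (\<lambda>p. p v) ps) \<inter> region t h v =
      interp cplx f (map (\<lambda>p. p v) qs) \<inter> region t h v" if "v \<in> valuations" for v
    unfolding interp_complex
    by (rule complex_interp_restrict[OF region_closed(2,3)])
      (use len th[OF that] in \<open>simp_all add: list_all2_map1 list_all2_map2\<close>)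
  with cond have "\<exists>t h. condition t h \<and> (\<forall>v\<in>valuations. interp cplx f (map (\<lambda>p. p v) ps) \<inter> region t h v =
      interp cplx f (map (\<lambda>p. p v) qs) \<inter> region t h v)"
    by blast
  moreover have "(\<lambda>v. interp cplx f (map (\<lambda>p. p v) ps)) \<in> carrier (power_algebra cplx)"
    "(\<lambda>v. interp cplx f (map (\<lambda>p. p v) qs)) \<in> carrier (power_algebra cplx)"
  proof -
    have "\<forall>p\<in>set ps \<union> set qs. p \<in> carrier (power_algebra cplx)"
      using pq by (induction rule: list_all2_induct) (auto dest: agree_carrier)
    then show "(\<lambda>v. interp cplx f (map (\<lambda>p. p v) ps)) \<in> carrier (power_algebra cplx)"
      "(\<lambda>v. interp cplx f (map (\<lambda>p. p v) qs)) \<in> carrier (power_algebra cplx)"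
      using len list_all2_lengthD[OF pq]
      by (auto simp: power_algebra_def intro!: is_algebraD[OF complex_is_algebra])
  qed
  ultimately show "(interp (power_algebra cplx) f ps, interp (power_algebra cplx) f qs) \<in> agree"
    by (simp add: agree_def power_algebra_def carrier_complex)
qed

text \<open>
  The value \<open>Y\<close> makes the generators open at every index; it is arbitrary otherwise, since \<open>agree\<close>
  looks only at indices in \<open>valuations\<close>.
\<close>

definition generator :: "'a \<Rightarrow> ('a \<Rightarrow> 'p set) \<Rightarrow> 'p set" where
  "generator a v = (if v \<in> valuations then v a else Y)"

lemma generator_upset: "generator a v \<in> upsets"
  by (auto simp: generator_def valuations_def upsets_closed)

text \<open>
  The equation \<open>f(x\<^sub>1, \<dots>) = x\<close> that holds in \<open>A\<close> for \<open>x\<close> the value of \<open>f\<close> is, as a biconditional, itself a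
  condition. On its region both sides agree.
\<close>

lemma generator_hom:
  assumes "length xs = arity f" and "set xs \<subseteq> carrier A"
  shows "(generator (interp A f xs), interp (open_algebra (power_algebra cplx)) f (map generator xs))
    \<in> agree"
proof -
  let ?iff = "\<lambda>s t. App HMeet [App HImp [s, t], App HImp [t, s]]"
  define s where "s = App f (map Var [0..<arity f])"
  define t where "t = ?iff s (Var (arity f))"
  define h where "h n = (if n < arity f then xs ! n else interp A f xs)" for n
  have h: "range h \<subseteq> carrier A"
    using assms is_algebraD[OF A assms] by (auto simp: h_def)
  have map_h: "map h [0..<arity f] = xs"
    using assms(1) by (auto simp: h_def intro: nth_equalityI)
  have "eval_trm A h s = interp A f xs"
    using map_h by (simp add: s_def comp_def)
  moreover have h_arity: "h (arity f) = interp A f xs"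
    by (simp add: h_def)
  ultimately have "eval_trm A h t = eval_trm A h (?iff (Var (arity f)) (Var (arity f)))"
    by (simp add: t_def)
  also have "\<dots> = eval_trm A h (App HOne [])"
    by (rule identity_transfer[OF _ _ h]) (auto simp: interp_open_complex)
  finally have cond: "condition t h"
    using h by (simp add: condition_def t_def s_def)
  have val: "interp (open_algebra (power_algebra cplx)) f (map generator xs) v =
      interp (open_algebra cplx) f (map (\<lambda>x. generator x v) xs)" for v
    using assms(1)
    by (cases f) (auto simp: interp_open_algebra power_algebra_def length_two_conv length_Suc_conv)
  have "generator (interp A f xs) v \<inter> region t h v =
      interp (open_algebra cplx) f (map (\<lambda>x. generator x v) xs) \<inter> region t h v"
    if "v \<in> valuations" for v
  proof -
    have "map (v \<circ> h) [0..<arity f] = map v xs"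
      using map_h by (metis map_map)
    then have "eval_trm (open_algebra cplx) (v \<circ> h) s = interp (open_algebra cplx) f (map v xs)"
      by (simp add: s_def comp_def)
    then have "region t h v \<subseteq>
        {x \<in> Y. x \<in> interp (open_algebra cplx) f (map v xs) \<longleftrightarrow> x \<in> v (interp A f xs)}"
      using region_subset[of t h v] R_refl by (auto simp: t_def interp_open_complex h_arity)
    then show ?thesis
      using that by (auto simp: generator_def)
  qed
  moreover have "interp (open_algebra cplx) f (map (\<lambda>x. generator x v) xs) \<in> upsets" for v
    using is_algebraD[OF open_complex_is_algebra, of "map (\<lambda>x. generator x v) xs" f] assms(1)
    by (simp add: carrier_open_complex generator_upset image_subset_iff)
  ultimately show ?thesis
    using cond generator_upset unfolding agree_def val upsets_def by blast
qed

text \<open>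
  If two generators agree on the region of \<open>t\<close>, then \<open>\<forall>t \<and> x = \<forall>t \<and> y\<close> is an identity of the open
  elements of the complex algebra, with variables \<open>x\<close> and \<open>y\<close> for \<open>a\<close> and \<open>b\<close>. So it holds in \<open>A\<close>, where
  \<open>t = 1\<close> turns it into \<open>a = b\<close>. The variables of \<open>t\<close> are renamed such that equal elements of \<open>A\<close> get the
  same variable; only the finitely many elements \<open>F\<close> that occur need a variable of their own.
\<close>

lemma generator_inj:
  assumes "a \<in> carrier A" and "b \<in> carrier A" and "(generator a, generator b) \<in> agree"
  shows "a = b"
proof -
  obtain t h where t: "wf_trm t" and h: "range h \<subseteq> carrier A" and one: "eval_trm A h t = interp A HOne []"
    and th: "\<And>v. v \<in> valuations \<Longrightarrow> v a \<inter> region t h v = v b \<inter> region t h v"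
    using assms(3) by (auto simp: agree_def condition_def generator_def)
  obtain N where "finite N"
    and N: "\<And>\<sigma> \<tau>. \<forall>n\<in>N. \<sigma> n = \<tau> n \<Longrightarrow> eval_trm A \<sigma> t = eval_trm A \<tau> t"
    using eval_trm_finite_support by metis
  define F where "F = insert a (insert b (h ` N))"
  have "finite F"
    using \<open>finite N\<close> by (simp add: F_def)
  from finite_imp_inj_to_nat_seg[OF this] obtain g :: "'a \<Rightarrow> nat" where g: "inj_on g F"
    by blast
  define t' where "t' = App HForall [rename_vars (g \<circ> h) t]"
  define \<tau> where "\<tau> n = (if n \<in> g ` F then inv_into F g n else a)" for n
  have F: "F \<subseteq> carrier A"
    using assms(1,2) h by (auto simp: F_def)
  have \<tau>: "\<tau> (g x) = x" if "x \<in> F" for x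
    using that g by (simp add: \<tau>_def)
  have range: "range \<tau> \<subseteq> carrier A"
  proof (clarify)
    fix n
    show "\<tau> n \<in> carrier A"
      using F assms(1) inv_into_into[of n g F] by (auto simp: \<tau>_def)
  qed
  have "eval_trm (open_algebra cplx) \<sigma> (App HMeet [t', Var (g a)]) =
      eval_trm (open_algebra cplx) \<sigma> (App HMeet [t', Var (g b)])" if "range \<sigma> \<subseteq> upsets" for \<sigma>
  proof -
    have "\<sigma> \<circ> g \<in> valuations"
      using that by (auto simp: valuations_def)
    from th[OF this] show ?thesis
      by (simp add: t'_def region_def eval_rename_vars interp_open_complex comp_assoc Int_commute)
  qed
  moreover have "wf_trm t'"
    using t by (simp add: t'_def wf_rename_vars)
  ultimately have "eval_trm A \<tau> (App HMeet [t', Var (g a)]) = eval_trm A \<tau> (App HMeet [t', Var (g b)])"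
    by (intro identity_transfer range) auto
  moreover have "eval_trm A (\<tau> \<circ> (g \<circ> h)) t = eval_trm A h t"
    using \<tau> by (intro N) (auto simp: F_def)
  moreover have "interp A HMeet [interp A HForall [interp A HOne []], x] = x" if "x \<in> carrier A" for x
    using identity_transfer[of "App HMeet [App HForall [App HOne []], Var 0]" "Var 0" "\<lambda>_. x"] that
    by (auto simp: interp_open_complex upsets_def dest: E_subset)
  ultimately show ?thesis
    using assms(1,2) one \<tau>[of a] \<tau>[of b] by (simp add: t'_def eval_rename_vars F_def)
qed


text \<open>
  The quotient of the power algebra may be larger than the universe of \<open>A\<close>. The subalgebra generated
  by the image of \<open>A\<close> is not, so it has a copy there.
\<close>

theorem embeds_in_open_algebra_of_hull:
  includes cardinal_syntax
  assumes inf: "infinite (UNIV :: 'a set)"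
  shows "\<exists>B :: (modal_op, 'a) alg. B \<in> equational_hull {cplx} \<and>
    (\<exists>h\<in>hom A (open_algebra B). inj_on h (carrier A))"
proof -
  let ?P = "power_algebra cplx :: (modal_op, ('a \<Rightarrow> 'p set) \<Rightarrow> 'p set) alg"
  let ?Q = "quotient_algebra ?P agree"
  let ?\<kappa> = "\<lambda>p. agree `` {p}"
  define \<eta> where "\<eta> = ?\<kappa> \<circ> generator"
  have P: "?P \<in> equational_hull {cplx}" "is_algebra ?P"
    using power_algebra_in_hull[OF complex_is_algebra] equational_hull_is_algebra by blast+
  have cong: "congruence ?P agree"
    by (rule congruence_agree)
  note Q = quotient_algebra[OF P(2) cong]
  have equiv: "equiv (carrier ?P) agree"
    using cong by (simp add: congruence_def)
  have gen_open: "generator a \<in> carrier (open_algebra ?P)" for a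
    using generator_upset[of a] carrier_open_complex
    by (auto simp: carrier_open_algebra power_algebra_def fun_eq_iff set_eq_iff)
  then have gen: "generator a \<in> carrier ?P" for a
    by (simp add: carrier_open_algebra)
  have \<kappa>: "?\<kappa> \<in> hom (open_algebra ?P) (open_algebra ?Q)"
    by (rule open_algebra_hom[OF P(2) Q(2)])
  have \<eta>_hom: "\<eta> (interp A f xs) = interp (open_algebra ?Q) f (map \<eta> xs)"
    if "length xs = arity f" "set xs \<subseteq> carrier A" for f xs
  proof -
    have "\<eta> (interp A f xs) = ?\<kappa> (interp (open_algebra ?P) f (map generator xs))"
      using equiv_class_eq[OF equiv generator_hom[OF that]] by (simp add: \<eta>_def)
    also have "\<dots> = interp (open_algebra ?Q) f (map ?\<kappa> (map generator xs))"
      using gen_open that(1) by (intro homD(2)[OF \<kappa>]) auto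
    finally show ?thesis
      by (simp add: \<eta>_def comp_def)
  qed
  have \<eta>_inj: "inj_on \<eta> (carrier A)"
  proof (rule inj_onI)
    fix a b assume "a \<in> carrier A" "b \<in> carrier A" "\<eta> a = \<eta> b"
    then show "a = b"
      using eq_equiv_class_iff[OF equiv gen gen] generator_inj by (simp add: \<eta>_def)
  qed
  have \<eta>_open: "\<eta> a \<in> carrier (open_algebra ?Q)" for a
    using homD(1)[OF \<kappa> gen_open] by (simp add: \<eta>_def)
  have card_\<eta>: "|\<eta> ` carrier A| \<le>o |UNIV :: 'a set|"
    using ordLeq_transitive[OF card_of_image card_of_mono1[OF subset_UNIV]] .
  have card_ops: "|UNIV :: modal_op set| \<le>o |UNIV :: 'a set|"
  proof -
    have "UNIV = {Zero, One, Meet, Join, Neg, Box, Forall}"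
      using modal_op.exhaust by blast
    then have "finite (UNIV :: modal_op set)"
      by (metis finite.emptyI finite.insertI)
    from finite_imp_inj_to_nat_seg[OF this] obtain g :: "modal_op \<Rightarrow> nat" where "inj g"
      by blast
    then have "|UNIV :: modal_op set| \<le>o |UNIV :: nat set|"
      using card_of_ordLeq[of "UNIV :: modal_op set" "UNIV :: nat set"] by blast
    then show ?thesis
      using inf ordLeq_transitive by (auto simp: infinite_iff_card_of_nat)
  qed
  have \<eta>_Q: "\<eta> ` carrier A \<subseteq> carrier ?Q"
    using \<eta>_open by (auto simp: carrier_open_algebra)
  from small_subalgebra[OF Q(1) \<eta>_Q inf card_ops card_\<eta>]
  obtain C where C: "subalgebra C ?Q" "\<eta> ` carrier A \<subseteq> carrier C"
    and "|carrier C| \<le>o |UNIV :: 'a set|"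
    by blast
  then have "\<exists>g :: _ \<Rightarrow> 'a. inj_on g (carrier C) \<and> g ` carrier C \<subseteq> UNIV"
    by (simp only: card_of_ordLeq)
  then obtain g :: "_ \<Rightarrow> 'a" where g: "inj_on g (carrier C)"
    by blast
  have algC: "is_algebra C"
    using C(1) by (simp add: subalgebra_def)
  obtain B :: "(modal_op, 'a) alg" where B: "B \<cong> C"
    using isomorphic_copy[OF algC g] by blast
  have "id \<in> hom C ?Q"
    using C(1) by (auto simp: hom_def subalgebra_def)
  then have "C \<in> equational_hull {cplx}"
    using equational_hull_embeds[OF equational_hull_image[OF P(1) Q] algC] by auto
  then have "B \<in> equational_hull {cplx}"
    using isomorphic_satisfies_iff[OF B] B by (auto simp: equational_hull_def isomorphic_def)
  have "\<eta> \<in> hom A (open_algebra C)"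
  proof -
    have \<eta>C: "\<eta> a \<in> carrier (open_algebra C)" if "a \<in> carrier A" for a
    proof -
      have "\<eta> a \<in> carrier C"
        using that C(2) by blast
      then have "interp C Box [\<eta> a] = interp ?Q Box [\<eta> a]"
        using C(1) by (simp add: subalgebra_def)
      then show ?thesis
        using \<eta>_open[of a] \<open>\<eta> a \<in> carrier C\<close> by (simp add: carrier_open_algebra)
    qed
    have "\<eta> (interp A f xs) = interp (open_algebra C) f (map \<eta> xs)"
      if "length xs = arity f" "set xs \<subseteq> carrier A" for f xs
      using homD(2)[OF open_algebra_hom[OF algC \<open>id \<in> hom C ?Q\<close>], of "map \<eta> xs" f] that \<eta>C
      by (auto simp: \<eta>_hom)
    then show ?thesis
      using \<eta>C by (auto simp: hom_def)
  qed
  obtain k where k: "k \<in> hom C B" "inj_on k (carrier C)"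
    using isomorphic_sym[OF B] by (auto simp: isomorphic_def bij_betw_def)
  have "k \<circ> \<eta> \<in> hom A (open_algebra B)"
    using hom_comp[OF \<open>\<eta> \<in> hom A (open_algebra C)\<close> open_algebra_hom[OF algC k(1)]] .
  moreover have "inj_on (k \<circ> \<eta>) (carrier A)"
    using comp_inj_on[OF \<eta>_inj] inj_on_subset[OF k(2) C(2)] by blast
  ultimately show ?thesis
    using \<open>B \<in> equational_hull {cplx}\<close> by blast
qed

end

end

section \<open>Two frames\<close>

lemma all_point: "(\<forall>p. P p) \<longleftrightarrow> P pt_u \<and> P pt_v \<and> P pt_w \<and> P pt_z"
  by (metis point.exhaust)

lemma bex_point: "(\<exists>p\<in>U. P p) \<longleftrightarrow>
    pt_u \<in> U \<and> P pt_u \<or> pt_v \<in> U \<and> P pt_v \<or> pt_w \<in> U \<and> P pt_w \<or> pt_z \<in> U \<and> P pt_z"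
  using all_point[of "\<lambda>p. \<not> (p \<in> U \<and> P p)"] by blast

definition Y2 :: "point set" where
  "Y2 = {pt_u, pt_v, pt_z}"

definition R2 :: "point rel" where
  "R2 = R1 \<inter> Y2 \<times> Y2"

definition E2 :: "point rel" where
  "E2 = E1 \<inter> Y2 \<times> Y2"

text \<open>
  The algebra of the subframe \<open>u < v < z\<close>, which is also the image of the first frame when \<open>w\<close> is
  collapsed to \<open>z\<close>.
\<close>

definition B2 :: "(modal_op, point set) alg" where
  "B2 = complex_algebra Y2 R2 E2"

lemma mem_Y1: "p \<in> Y1"
  by (cases p) (simp_all add: Y1_def)

lemma mem_Y2: "p \<in> Y2 \<longleftrightarrow> p \<noteq> pt_w"
  by (cases p) (simp_all add: Y2_def)

lemma mem_R1: "(p, q) \<in> R1 \<longleftrightarrow> p = q \<or> p = pt_u \<or> q = pt_z"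
  by (cases p; cases q) (simp_all add: R1_def Id_on_iff Y1_def)

lemma mem_E1: "(p, q) \<in> E1 \<longleftrightarrow> p = q \<or> p \<in> {pt_v, pt_z} \<and> q \<in> {pt_v, pt_z}"
  by (cases p; cases q) (simp_all add: E1_def)

lemma mem_R2: "(p, q) \<in> R2 \<longleftrightarrow> (p, q) \<in> R1 \<and> p \<noteq> pt_w \<and> q \<noteq> pt_w"
  and mem_E2: "(p, q) \<in> E2 \<longleftrightarrow> (p, q) \<in> E1 \<and> p \<noteq> pt_w \<and> q \<noteq> pt_w"
  by (auto simp: R2_def E2_def mem_Y2)

lemmas mem_simps = mem_Y1 mem_Y2 mem_R2 mem_E2 mem_R1 mem_E1

lemma finite_points: "finite (U :: point set)"
  by (rule finite_subset[of _ Y1]) (use mem_Y1 in \<open>auto simp: Y1_def\<close>)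

interpretation K1: MS4_frame Y1 R1 E1
proof
  show "equiv Y1 E1"
    by (rule equivI) (auto simp: refl_on_def sym_def trans_def mem_simps)
qed (auto simp: mem_simps)

interpretation K2: MS4_frame Y2 R2 E2
proof
  show "equiv Y2 E2"
    by (rule equivI) (auto simp: refl_on_def sym_def trans_def mem_simps)
qed (auto simp: mem_simps)

lemma B1_eq: "B1 = K1.cplx" and B2_eq: "B2 = K2.cplx"
  by (simp_all add: B1_def B2_def)

lemma B1_MGrz: "B1 \<in> MGrz_algebras"
  unfolding B1_eq
  by (rule K1.complex_MGrz) (auto simp: finite_points antisym_def mem_simps)

lemma B2_MGrz: "B2 \<in> MGrz_algebras"
  unfolding B2_eq
  by (rule K2.complex_MGrz) (auto simp: finite_points antisym_def mem_simps)

lemma upsets_K2_iff: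
  "U \<in> K2.upsets \<longleftrightarrow> pt_w \<notin> U \<and> (pt_u \<in> U \<longrightarrow> pt_v \<in> U) \<and> (pt_v \<in> U \<longrightarrow> pt_z \<in> U)"
  by (simp add: K2.upsets_def subset_eq Ball_def all_point Image_iff bex_point mem_simps) blast

lemma upsets_K1_iff:
  "U \<in> K1.upsets \<longleftrightarrow> (pt_u \<in> U \<longrightarrow> pt_v \<in> U \<and> pt_w \<in> U) \<and> (pt_v \<in> U \<or> pt_w \<in> U \<longrightarrow> pt_z \<in> U)"
  by (simp add: K1.upsets_def subset_eq Ball_def all_point Image_iff bex_point mem_simps) blast

text \<open>
  Inverse image under the map that sends \<open>w\<close> to \<open>z\<close> and fixes the other points.
\<close>

definition preimage :: "point set \<Rightarrow> point set" where
  "preimage U = U \<union> (if pt_z \<in> U then {pt_w} else {})"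

lemma mem_preimage: "p \<in> preimage U \<longleftrightarrow> p \<in> U \<or> p = pt_w \<and> pt_z \<in> U"
  by (auto simp: preimage_def)

lemma preimage_hom: "preimage \<in> hom (open_algebra B2) (open_algebra B1)"
proof -
  have "preimage U \<in> K1.upsets" if "U \<in> K2.upsets" for U
    using that by (auto simp: upsets_K1_iff upsets_K2_iff mem_preimage)
  moreover have "preimage (interp (open_algebra B2) f xs) = interp (open_algebra B1) f (map preimage xs)"
    if "length xs = arity f" and xs: "set xs \<subseteq> K2.upsets" for f xs
    using that
    by (cases f) (auto simp: set_eq_iff all_point length_two_conv length_Suc_conv B1_eq B2_eq
        K1.interp_open_complex K2.interp_open_complex upsets_K2_iff mem_simps mem_preimage
        Image_iff bex_point)
  ultimately show ?thesis
    by (auto simp: hom_def B1_eq B2_eq K1.carrier_open_complex K2.carrier_open_complex)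
qed

lemma preimage_inj: "inj_on preimage (carrier (open_algebra B2))"
  by (auto simp: inj_on_def B2_eq K2.carrier_open_complex upsets_K2_iff set_eq_iff all_point
      mem_preimage)

text \<open>
  In a complex algebra, the part of \<open>c\<close> that is \<open>E\<close>-related to points of \<open>\<exists>c\<close> outside \<open>c\<close>. Negation under \<open>\<exists>\<close> is classical here,
  so that this is a modal but not a Heyting term.
\<close>

definition trace :: "(modal_op, 'a) alg \<Rightarrow> 'a \<Rightarrow> 'a" where
  "trace B c = (let ex = (\<lambda>a. interp B Neg [interp B Forall [interp B Neg [a]]])
     in interp B Meet [c, ex (interp B Meet [ex c, interp B Neg [c]])])"

abbreviation ex_trm :: "modal_op trm \<Rightarrow> modal_op trm" where
  "ex_trm s \<equiv> App Neg [App Forall [App Neg [s]]]"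

abbreviation imp_trm :: "modal_op trm \<Rightarrow> modal_op trm \<Rightarrow> modal_op trm" where
  "imp_trm s t \<equiv> App Box [App Join [App Neg [s], t]]"

text \<open>
  Implications \<open>\<exists>x \<rightarrow> x\<close> with \<open>x\<close> open. They make the condition \<open>(\<exists>c \<rightarrow> c) = c\<close> on \<open>c\<close> available to
  identities: an open \<open>c\<close> satisfying it is the value of this term at \<open>x = c\<close>.
\<close>

definition stable_trm :: "modal_op trm" where
  "stable_trm = imp_trm (ex_trm (App Box [Var 0])) (App Box [Var 0])"

definition trace_trm :: "modal_op trm" where
  "trace_trm = App Meet [stable_trm, ex_trm (App Meet [ex_trm stable_trm, App Neg [stable_trm]])]"

lemma eval_stable_trm_B1: "eval_trm B1 \<sigma> stable_trm \<in> {{pt_w, pt_z}, Y1}"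
proof -
  define U where "U = interp B1 Box [\<sigma> 0]"
  have U: "pt_u \<in> U \<longrightarrow> pt_v \<in> U \<and> pt_w \<in> U" "pt_v \<in> U \<longrightarrow> pt_z \<in> U" "pt_w \<in> U \<longrightarrow> pt_z \<in> U"
    by (auto simp: U_def B1_eq K1.interp_complex mem_simps)
  have "eval_trm B1 \<sigma> stable_trm = interp (open_algebra B1) HImp [interp (open_algebra B1) HExists [U], U]"
    by (simp add: stable_trm_def U_def interp_open_algebra)
  also have "\<dots> = (if pt_z \<in> U \<and> pt_v \<notin> U then {pt_w, pt_z} else Y1)"
    using U by (auto simp: set_eq_iff all_point B1_eq K1.interp_open_complex mem_simps
        Image_iff bex_point)
  finally show ?thesis
    by simp
qed

lemma eval_trace_trm_B1:
  "eval_trm B1 \<sigma> trace_trm = (if eval_trm B1 \<sigma> stable_trm = Y1 then {} else {pt_z})"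
proof -
  have "eval_trm B1 \<sigma> trace_trm = trace B1 (eval_trm B1 \<sigma> stable_trm)"
    by (simp add: trace_trm_def trace_def Let_def)
  also have "trace B1 Y1 = {}" "trace B1 {pt_w, pt_z} = {pt_z}"
    by (auto simp: set_eq_iff all_point trace_def Let_def B1_eq K1.interp_complex mem_simps
        Image_iff bex_point)
  then have "trace B1 (eval_trm B1 \<sigma> stable_trm) = (if eval_trm B1 \<sigma> stable_trm = Y1 then {} else {pt_z})"
    using eval_stable_trm_B1[of \<sigma>] by auto
  finally show ?thesis .
qed

lemma wz_neq_Y1: "{pt_w, pt_z} \<noteq> Y1"
  using mem_Y1[of pt_u] by auto

lemma eval_trace: "eval_trm B \<sigma> trace_trm = trace B (eval_trm B \<sigma> stable_trm)"
  by (simp add: trace_trm_def trace_def Let_def)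

lemma eval_stable_trm:
  assumes "c \<in> carrier (open_algebra B)"
    and "interp (open_algebra B) HImp [interp (open_algebra B) HExists [c], c] = c"
  shows "eval_trm B (\<lambda>_. c) stable_trm = c"
  using assms by (simp add: stable_trm_def interp_open_algebra carrier_open_algebra)

lemma wf_stable_trace_trm: "wf_trm stable_trm" "wf_trm trace_trm"
  by (simp_all add: trace_trm_def stable_trm_def)

text \<open>
  These are identities in \<open>stable_trm\<close> and \<open>trace_trm\<close>. In \<open>B1\<close> the pair of their values is
  \<open>({w, z}, {z})\<close> or \<open>(Y1, {})\<close>, which leaves two cases to compute.
\<close>

lemma trace_in_hull_B1:
  assumes B: "B \<in> equational_hull {B1}" and c: "c \<in> carrier (open_algebra B)"
    and stable: "interp (open_algebra B) HImp [interp (open_algebra B) HExists [c], c] = c"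
  defines "I \<equiv> interp (open_algebra B)" and "t \<equiv> trace B c"
  shows "t \<in> carrier (open_algebra B)"
    and "I HMeet [t, c] = t"
    and "I HMeet [I HImp [c, t], I HExists [c]] = I HImp [c, t]"
    and "I HMeet [I HExists [c], I HJoin [c, I HExists [t]]] = I HExists [c]"
proof -
  have range: "range (\<lambda>_. c) \<subseteq> carrier B"
    using c by (auto simp: carrier_open_algebra)
  have t: "eval_trm B (\<lambda>_. c) trace_trm = t"
    by (simp add: t_def eval_trace eval_stable_trm[OF c stable])
  note eval = eval_stable_trm[OF c stable] t
  have transfer: "eval_trm B (\<lambda>_. c) r = eval_trm B (\<lambda>_. c) s"
    if "wf_trm r" "wf_trm s"
      and "\<And>\<sigma>. eval_trm B1 \<sigma> stable_trm = {pt_w, pt_z} \<Longrightarrow> eval_trm B1 \<sigma> trace_trm = {pt_z} \<Longrightarrow>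
        eval_trm B1 \<sigma> r = eval_trm B1 \<sigma> s"
      and "\<And>\<sigma>. eval_trm B1 \<sigma> stable_trm = Y1 \<Longrightarrow> eval_trm B1 \<sigma> trace_trm = {} \<Longrightarrow>
        eval_trm B1 \<sigma> r = eval_trm B1 \<sigma> s" for r s
  proof (rule equational_hullD[OF B that(1,2) _ range])
    fix M and \<sigma> :: "nat \<Rightarrow> point set" assume "M \<in> {B1}"
    then show "eval_trm M \<sigma> r = eval_trm M \<sigma> s"
      using that(3,4)[of \<sigma>] eval_stable_trm_B1[of \<sigma>] eval_trace_trm_B1[of \<sigma>] wz_neq_Y1
      by (elim insertE; simp)
  qed
  note B1_simps = set_eq_iff all_point B1_eq K1.interp_complex mem_simps Image_iff bex_point
  have "t \<in> carrier B"
    using eval_trm_closed[OF equational_hull_is_algebra[OF B] range wf_stable_trace_trm(2)] t by simp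
  moreover have "eval_trm B (\<lambda>_. c) (App Box [trace_trm]) = eval_trm B (\<lambda>_. c) trace_trm"
    by (rule transfer) (simp_all add: wf_stable_trace_trm, (simp (no_asm) add: B1_simps)+)
  ultimately show "t \<in> carrier (open_algebra B)"
    by (simp add: eval carrier_open_algebra)
  have "eval_trm B (\<lambda>_. c) (App Meet [trace_trm, stable_trm]) = eval_trm B (\<lambda>_. c) trace_trm"
    by (rule transfer) (simp_all add: wf_stable_trace_trm, (simp (no_asm) add: B1_simps)+)
  then show "I HMeet [t, c] = t"
    by (simp add: eval I_def interp_open_algebra)
  have "eval_trm B (\<lambda>_. c) (App Meet [imp_trm stable_trm trace_trm, ex_trm stable_trm]) =
      eval_trm B (\<lambda>_. c) (imp_trm stable_trm trace_trm)"
    by (rule transfer) (simp_all add: wf_stable_trace_trm, (simp (no_asm) add: B1_simps)+)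
  then show "I HMeet [I HImp [c, t], I HExists [c]] = I HImp [c, t]"
    by (simp add: eval I_def interp_open_algebra)
  have "eval_trm B (\<lambda>_. c) (App Meet [ex_trm stable_trm, App Join [stable_trm, ex_trm trace_trm]]) =
      eval_trm B (\<lambda>_. c) (ex_trm stable_trm)"
    by (rule transfer) (simp_all add: wf_stable_trace_trm, (simp (no_asm) add: B1_simps)+)
  then show "I HMeet [I HExists [c], I HJoin [c, I HExists [t]]] = I HExists [c]"
    by (simp add: eval I_def interp_open_algebra)
qed

text \<open>
  In \<open>B2\<close> the value of \<open>stable_trm\<close> is \<open>{z}\<close>, which is its own trace, or \<open>Y2\<close>, which is fixed by \<open>\<box>\<forall>\<close>.
\<close>

lemma trace_in_hull_B2:
  assumes B: "B \<in> equational_hull {B2}" and c: "c \<in> carrier (open_algebra B)"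
    and stable: "interp (open_algebra B) HImp [interp (open_algebra B) HExists [c], c] = c"
  shows "interp (open_algebra B) HJoin [trace B c, interp (open_algebra B) HForall [c]] = c"
proof -
  have "eval_trm B (\<lambda>_. c) (App Join [trace_trm, App Box [App Forall [stable_trm]]]) = eval_trm B (\<lambda>_. c) stable_trm"
  proof (rule equational_hullD[OF B])
    fix M and \<sigma> :: "nat \<Rightarrow> point set" assume "M \<in> {B2}" "range \<sigma> \<subseteq> carrier M"
    define U where "U = interp B2 Box [\<sigma> 0]"
    have U: "pt_w \<notin> U" "pt_u \<in> U \<longrightarrow> pt_v \<in> U" "pt_v \<in> U \<longrightarrow> pt_z \<in> U"
      by (auto simp: U_def B2_eq K2.interp_complex Image_iff bex_point mem_simps)
    have "eval_trm B2 \<sigma> stable_trm = interp (open_algebra B2) HImp [interp (open_algebra B2) HExists [U], U]"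
      by (simp add: stable_trm_def U_def interp_open_algebra)
    also have "\<dots> = (if pt_z \<in> U \<and> pt_v \<notin> U then {pt_z} else Y2)"
      using U by (auto simp: set_eq_iff all_point B2_eq K2.interp_open_complex mem_simps
          Image_iff bex_point)
    finally have "eval_trm B2 \<sigma> stable_trm \<in> {{pt_z}, Y2}"
      by simp
    moreover have "interp B2 Join [trace B2 C, interp B2 Box [interp B2 Forall [C]]] = C"
      if "C \<in> {{pt_z}, Y2}" for C
      using that by (auto simp: set_eq_iff all_point trace_def Let_def B2_eq K2.interp_complex
          mem_simps Image_iff bex_point)
    ultimately have "eval_trm B2 \<sigma> (App Join [trace_trm, App Box [App Forall [stable_trm]]]) = eval_trm B2 \<sigma> stable_trm"
      by (simp add: eval_trace)
    then show "eval_trm M \<sigma> (App Join [trace_trm, App Box [App Forall [stable_trm]]]) = eval_trm M \<sigma> stable_trm"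
      using \<open>M \<in> {B2}\<close> by simp
  qed (use c in \<open>auto simp: wf_stable_trace_trm carrier_open_algebra\<close>)
  then show ?thesis
    by (simp add: eval_trace eval_stable_trm[OF c stable] interp_open_algebra)
qed

section \<open>Separating the operators\<close>

lemma open_B2:
  "carrier (open_algebra B2) = {U. pt_w \<notin> U \<and> (pt_u \<in> U \<longrightarrow> pt_v \<in> U) \<and> (pt_v \<in> U \<longrightarrow> pt_z \<in> U)}"
  by (auto simp: B2_eq K2.carrier_open_complex upsets_K2_iff)

lemma open_B2_values:
  defines "I \<equiv> interp (open_algebra B2)"
  shows "I HExists [{pt_z}] = {pt_v, pt_z}" and "I HImp [{pt_v, pt_z}, {pt_z}] = {pt_z}"
    and "I HImp [{pt_z}, {pt_z}] = Y2" and "I HForall [{pt_z}] = {}"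
    and "I HMeet [Y2, {pt_v, pt_z}] = {pt_v, pt_z}" and "I HExists [{}] = {}"
    and "I HJoin [{pt_z}, {}] = {pt_z}" and "I HMeet [{pt_v, pt_z}, {pt_z}] = {pt_z}"
  by (auto simp: I_def B2_eq K2.interp_open_complex set_eq_iff all_point mem_simps)

lemma open_B2_hom_values:
  assumes "h \<in> hom (open_algebra B2) (open_algebra B)"
  shows "U \<in> carrier (open_algebra B2) \<Longrightarrow>
      interp (open_algebra B) HExists [h U] = h (interp (open_algebra B2) HExists [U])"
    and "U \<in> carrier (open_algebra B2) \<Longrightarrow>
      interp (open_algebra B) HForall [h U] = h (interp (open_algebra B2) HForall [U])"
    and "U \<in> carrier (open_algebra B2) \<Longrightarrow> V \<in> carrier (open_algebra B2) \<Longrightarrow>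
      interp (open_algebra B) HMeet [h U, h V] = h (interp (open_algebra B2) HMeet [U, V])"
    and "U \<in> carrier (open_algebra B2) \<Longrightarrow> V \<in> carrier (open_algebra B2) \<Longrightarrow>
      interp (open_algebra B) HJoin [h U, h V] = h (interp (open_algebra B2) HJoin [U, V])"
    and "U \<in> carrier (open_algebra B2) \<Longrightarrow> V \<in> carrier (open_algebra B2) \<Longrightarrow>
      interp (open_algebra B) HImp [h U, h V] = h (interp (open_algebra B2) HImp [U, V])"
  using homD(2)[OF assms, of "[U]"] homD(2)[OF assms, of "[U, V]"] by simp_all

lemma open_B2_carrier:
  "{} \<in> carrier (open_algebra B2)" "{pt_z} \<in> carrier (open_algebra B2)"
  "{pt_v, pt_z} \<in> carrier (open_algebra B2)" "Y2 \<in> carrier (open_algebra B2)"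
  by (simp_all add: open_B2 mem_Y2)

text \<open>
  For \<open>c\<close> the image of \<open>{z}\<close> and \<open>t = c\<close>, the inequality \<open>c \<rightarrow> t \<le> \<exists>c\<close> would say that \<open>{v, z}\<close> is
  everything.
\<close>

lemma trace_neq:
  assumes B: "B \<in> equational_hull {B1}"
    and h: "h \<in> hom (open_algebra B2) (open_algebra B)" and inj: "inj_on h (carrier (open_algebra B2))"
  shows "trace B (h {pt_z}) \<noteq> h {pt_z}"
proof
  assume t: "trace B (h {pt_z}) = h {pt_z}"
  have "h {pt_z} \<in> carrier (open_algebra B)"
    using homD(1)[OF h] open_B2_carrier by blast
  moreover have "interp (open_algebra B) HImp [interp (open_algebra B) HExists [h {pt_z}], h {pt_z}] = h {pt_z}"
    by (simp add: open_B2_hom_values[OF h] open_B2_carrier open_B2_values)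
  ultimately have "h (interp (open_algebra B2) HMeet [Y2, {pt_v, pt_z}]) = h Y2"
    using trace_in_hull_B1(3)[OF B, of "h {pt_z}"] unfolding t
    by (simp add: open_B2_hom_values[OF h] open_B2_carrier open_B2_values)
  then have "Y2 = {pt_v, pt_z}"
    using inj open_B2_carrier by (simp add: open_B2_values inj_on_eq_iff)
  then show False
    using mem_Y2[of pt_u] by auto
qed

text \<open>
  Surjectivity of \<open>h\<close> puts the trace of \<open>{z}\<close> into the image, so it corresponds to an upset below \<open>{z}\<close>.
  The empty upset violates \<open>\<exists>c \<le> c \<or> \<exists>t\<close>, and \<open>{z}\<close> itself is excluded by \<open>trace_neq\<close>.
\<close>

lemma open_B2_not_open_algebra:
  assumes B: "B \<in> equational_hull {B1}"
    and h: "h \<in> hom (open_algebra B2) (open_algebra B)"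
    and bij: "bij_betw h (carrier (open_algebra B2)) (carrier (open_algebra B))"
  shows False
proof -
  let ?I = "interp (open_algebra B)" and ?c = "h {pt_z}"
  have inj: "inj_on h (carrier (open_algebra B2))"
    using bij by (simp add: bij_betw_def)
  have c: "?c \<in> carrier (open_algebra B)"
    using homD(1)[OF h] open_B2_carrier by blast
  have "?I HImp [?I HExists [?c], ?c] = ?c"
    by (simp add: open_B2_hom_values[OF h] open_B2_carrier open_B2_values)
  note trace = trace_in_hull_B1[OF B c this]
  obtain U where U: "U \<in> carrier (open_algebra B2)" "trace B ?c = h U"
    using trace(1) bij by (auto simp: bij_betw_def)
  have "h (interp (open_algebra B2) HMeet [U, {pt_z}]) = h U"
    using trace(2) U by (simp add: open_B2_hom_values[OF h] open_B2_carrier)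
  moreover have "interp (open_algebra B2) HMeet [U, {pt_z}] = U \<inter> {pt_z}"
    by (simp add: B2_eq K2.interp_open_complex)
  moreover have "U \<inter> {pt_z} \<in> carrier (open_algebra B2)"
    using U by (auto simp: open_B2)
  ultimately have "U \<inter> {pt_z} = U"
    using inj U by (simp add: inj_on_eq_iff)
  then consider "U = {}" | "U = {pt_z}"
    by (cases "pt_z \<in> U") auto
  then show False
  proof cases
    case 1
    then have "h {pt_z} = h {pt_v, pt_z}"
      using trace(4) U by (simp add: open_B2_hom_values[OF h] open_B2_carrier open_B2_values)
    then have "{pt_z} = {pt_v, pt_z}"
      using inj open_B2_carrier by (simp add: inj_on_eq_iff)
    then show False
      by auto
  next
    case 2
    then show False
      using trace_neq[OF B h inj] U by simp
  qed
qed

text \<open>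
  Here the trace need not lie in the image of \<open>h\<close>; instead \<open>t \<or> \<box>\<forall>c = c\<close>, which holds in the hull of
  \<open>B2\<close>, forces it to be equal to \<open>c\<close>.
\<close>

lemma open_B2_not_embedded:
  assumes B1: "B \<in> equational_hull {B1}" and B2: "B \<in> equational_hull {B2}" and "B \<in> MGrz_algebras"
    and h: "h \<in> hom (open_algebra B2) (open_algebra B)" and inj: "inj_on h (carrier (open_algebra B2))"
  shows False
proof -
  interpret MGrz_on "carrier B" "\<lambda>a b. interp B Meet [a, b]" "\<lambda>a b. interp B Join [a, b]"
    "interp B Zero []" "interp B One []" "\<lambda>a. interp B Neg [a]" "\<lambda>a. interp B Box [a]"
    "\<lambda>a. interp B Forall [a]"
    using assms(3) by (simp add: MGrz_algebras_def)
  let ?I = "interp (open_algebra B)" and ?c = "h {pt_z}"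
  have c: "?c \<in> carrier (open_algebra B)"
    using homD(1)[OF h] open_B2_carrier by blast
  have stable: "?I HImp [?I HExists [?c], ?c] = ?c"
    by (simp add: open_B2_hom_values[OF h] open_B2_carrier open_B2_values)
  have "?I HForall [?c] = h {}"
    by (simp add: open_B2_hom_values[OF h] open_B2_carrier open_B2_values)
  moreover have "h {} = interp B Zero []"
    using homD(2)[OF h, of "[]" HZero] by (simp add: interp_open_algebra B2_eq K2.interp_complex)
  ultimately have "interp B Join [trace B ?c, interp B Zero []] = ?c"
    using trace_in_hull_B2[OF B2 c stable] by (simp add: interp_open_algebra)
  moreover have "trace B ?c \<in> carrier B"
    using trace_in_hull_B1(1)[OF B1 c stable] by (simp add: carrier_open_algebra)
  ultimately have "trace B ?c = ?c"
    using join_zero by simp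
  then show False
    using trace_neq[OF B1 h inj] by simp
qed

lemma equational_hull_MGrz:
  assumes "K \<subseteq> MGrz_algebras"
  shows "equational_hull K \<subseteq> MGrz_algebras"
proof
  fix A assume A: "A \<in> equational_hull K"
  have "A \<Turnstile> e" if "e \<in> MGrz_identities" for e
  proof (cases e)
    case (Pair s t)
    then have "\<forall>B\<in>K. B \<Turnstile> (s, t)"
      using satisfies_MGrz_identities assms that by blast
    then show ?thesis
      using A wf_MGrz_identities[of s t] that Pair by (simp add: equational_hull_def)
  qed
  then show "A \<in> MGrz_algebras"
    using A by (simp add: MGrz_if_identities equational_hull_is_algebra)
qed

lemma isomorphic_refl: "is_algebra A \<Longrightarrow> A \<cong> A"
  by (auto simp: isomorphic_def hom_def bij_betw_def intro!: exI[of _ id] bexI[of _ id])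

lemma open_algebras_is_algebra: "A \<in> \<O> K \<Longrightarrow> is_algebra A"
  by (auto simp: open_algebras_def isomorphic_def)

lemma in_subalgebras_open_algebras_iff:
  assumes "\<And>B. B \<in> K \<Longrightarrow> is_algebra (open_algebra B)"
  shows "A \<in> \<S> (\<O> K) \<longleftrightarrow>
    is_algebra A \<and> (\<exists>B\<in>K. \<exists>h\<in>hom A (open_algebra B). inj_on h (carrier A))" (is "_ \<longleftrightarrow> ?R")
proof
  assume "A \<in> \<S> (\<O> K)"
  then obtain D h where "is_algebra A" "D \<in> \<O> K" and h: "h \<in> hom A D" "inj_on h (carrier A)"
    using in_subalgebras_iff[where K = "\<O> K" and A = A, OF open_algebras_is_algebra[where K = K]] by blast
  then obtain B g where "B \<in> K" and g: "g \<in> hom D (open_algebra B)" "inj_on g (carrier D)"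
    by (auto simp: open_algebras_def isomorphic_def bij_betw_def)
  have "inj_on (g \<circ> h) (carrier A)"
    using h g by (intro comp_inj_on inj_on_subset[OF g(2)]) (auto simp: hom_def)
  then show ?R
    using \<open>is_algebra A\<close> \<open>B \<in> K\<close> hom_comp[OF h(1) g(1)] by blast
next
  assume ?R
  then obtain B h where "is_algebra A" "B \<in> K" "h \<in> hom A (open_algebra B)" "inj_on h (carrier A)"
    by blast
  moreover from this have "open_algebra B \<in> \<O> K"
    using isomorphic_refl[OF assms] by (auto simp: open_algebras_def)
  ultimately show "A \<in> \<S> (\<O> K)"
    using in_subalgebras_iff[where K = "\<O> K" and A = A, OF open_algebras_is_algebra[where K = K]] by blast
qed

lemma open_algebra_hull_is_algebra:
  assumes "K \<subseteq> {B1, B2}" and "B \<in> equational_hull K"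
  shows "is_algebra (open_algebra B)"
proof (rule open_algebra_in_hull[OF _ assms(2)])
  fix M assume "M \<in> K"
  then show "is_algebra (open_algebra M) \<and> (\<forall>a\<in>carrier M. interp M Box [a] \<in> carrier (open_algebra M))"
    using assms(1) K1.open_complex_is_algebra K1.Box_complex_open K2.open_complex_is_algebra K2.Box_complex_open
    by (auto simp: B1_eq B2_eq)
qed

text \<open>
  Since \<open>\<O>(B2)\<close> embeds into \<open>\<O>(B1)\<close>, adjoining \<open>B2\<close> to the generators costs no Heyting identity.
\<close>

lemma open_algebra_identities:
  assumes "B \<in> equational_hull {B1, B2}" and "open_algebra B1 \<Turnstile> (s, t)" and wf: "wf_trm s" "wf_trm t"
  shows "open_algebra B \<Turnstile> (s, t)"
proof -
  have "open_algebra B2 \<Turnstile> (s, t)"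
    using satisfies_if_embeds[OF _ preimage_hom preimage_inj wf assms(2)] K2.open_complex_is_algebra
    by (simp add: B2_eq)
  then have "M \<Turnstile> (open_trm s, open_trm t)" if "M \<in> {B1, B2}" for M
    using that assms(2) satisfies_open_trm[OF _ wf] K1.Box_complex_open K2.Box_complex_open
    by (auto simp: B1_eq B2_eq)
  then have "B \<Turnstile> (open_trm s, open_trm t)"
    using assms(1) wf_open_trm wf by (simp add: equational_hull_def)
  then show ?thesis
    by (rule open_algebra_satisfies[OF _ wf])
qed

theorem theorem6p16:
  fixes V1 :: "(modal_op, 'a) alg set"
  assumes "infinite (UNIV :: 'a set)"
    and "V1 = generated_variety B1"
  shows
    "(variety_of MGrz_algebras V1 \<and>
      \<O> V1 \<subseteq> monadic_heyting_algebras \<and> \<not> variety (\<O> V1)) \<and>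
     (\<exists>K :: (modal_op, 'a) alg set. K \<subseteq> MS4_algebras \<and> \<S> (\<O> K) \<noteq> \<O> (\<S> K)) \<and>
     (\<exists>V W :: (modal_op, 'a) alg set.
        variety_of MGrz_algebras V \<and> variety_of MGrz_algebras W \<and>
        \<S> (\<O> (V \<inter> W)) \<noteq> \<S> (\<O> V) \<inter> \<S> (\<O> W)) \<and>
     (\<exists>V W :: (modal_op, 'a) alg set.
        variety_of MGrz_algebras V \<and> variety_of MGrz_algebras W \<and>
        V \<noteq> W \<and> \<S> (\<O> V) = \<S> (\<O> W))"
proof -
  note inf = assms(1)
  have alg: "is_algebra B1" "is_algebra B2" "is_algebra (open_algebra B2)"
    using K1.complex_is_algebra K2.complex_is_algebra K2.open_complex_is_algebra
    by (simp_all add: B1_eq B2_eq)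
  have fin: "finite (X :: point set set)" for X
    by (rule finite_subset[OF _ finite_Pow_iff[THEN iffD2, OF finite_points[of UNIV]]]) auto
  obtain C1 C2 :: "(modal_op, 'a) alg" and A :: "(heyting_op, 'a) alg"
    where C1: "C1 \<cong> B1" and C2: "C2 \<cong> B2" and A: "A \<cong> open_algebra B2"
    using isomorphic_copy_finite[OF _ fin inf] alg by metis
  define W where "W = (equational_hull {B2} :: (modal_op, 'a) alg set)"
  define J where "J = (equational_hull {B1, B2} :: (modal_op, 'a) alg set)"
  have V1: "V1 = equational_hull {B1}"
    unfolding assms(2) by (rule generated_variety_eq_hull[OF C1])
  have MGrz: "variety_of MGrz_algebras V1" "variety_of MGrz_algebras W" "variety_of MGrz_algebras J"
    unfolding V1 W_def J_def variety_of_def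
    using equational_hull_MGrz[of "{B1}"] equational_hull_MGrz[of "{B2}"]
      equational_hull_MGrz[of "{B1, B2}"] B1_MGrz B2_MGrz by (simp_all add: variety_equational_hull)
  have sub: "V1 \<subseteq> J" "W \<subseteq> J"
    unfolding V1 W_def J_def by (rule equational_hull_mono; blast)+
  have SO: "D \<in> \<S> (\<O> K) \<longleftrightarrow>
      is_algebra D \<and> (\<exists>B\<in>K. \<exists>h\<in>hom D (open_algebra B). inj_on h (carrier D))"
    if "K \<subseteq> J" for D and K :: "(modal_op, 'a) alg set"
    by (rule in_subalgebras_open_algebras_iff)
      (use that open_algebra_hull_is_algebra[of "{B1, B2}"] in \<open>auto simp: J_def\<close>)

  have C1_V1: "C1 \<in> V1" and C2_W: "C2 \<in> W"
    unfolding V1 W_def by (auto intro: equational_hullI C1 C2)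
  obtain a where A_alg: "is_algebra A" and a: "a \<in> hom A (open_algebra B2)"
    and a_bij: "bij_betw a (carrier A) (carrier (open_algebra B2))"
    using A by (auto simp: isomorphic_def)
  then have a_inj: "inj_on a (carrier A)" and a_sub: "a ` carrier A \<subseteq> carrier (open_algebra B2)"
    by (auto simp: bij_betw_def)
  obtain a' where a': "a' \<in> hom (open_algebra B2) A" "bij_betw a' (carrier (open_algebra B2)) (carrier A)"
    using isomorphic_sym[OF A] by (auto simp: isomorphic_def)
  obtain c1 where c1: "c1 \<in> hom (open_algebra B1) (open_algebra C1)" "inj_on c1 (carrier (open_algebra B1))"
  proof -
    obtain k where k: "k \<in> hom B1 C1" "inj_on k (carrier B1)"
      using isomorphic_sym[OF C1] by (auto simp: isomorphic_def bij_betw_def)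
    moreover have "carrier (open_algebra B1) \<subseteq> carrier B1"
      by (auto simp: carrier_open_algebra)
    ultimately show ?thesis
      using that open_algebra_hom[OF alg(1) k(1)] inj_on_subset by blast
  qed
  obtain c2 where c2: "c2 \<in> hom (open_algebra B2) (open_algebra C2)" "inj_on c2 (carrier (open_algebra B2))"
  proof -
    obtain k where k: "k \<in> hom B2 C2" "inj_on k (carrier B2)"
      using isomorphic_sym[OF C2] by (auto simp: isomorphic_def bij_betw_def)
    moreover have "carrier (open_algebra B2) \<subseteq> carrier B2"
      by (auto simp: carrier_open_algebra)
    ultimately show ?thesis
      using that open_algebra_hom[OF alg(2) k(1)] inj_on_subset by blast
  qed

  have A_SO_W: "A \<in> \<S> (\<O> W)"
    unfolding SO[OF sub(2)]
    using A_alg C2_W hom_comp[OF a c2(1)] comp_inj_on[OF a_inj inj_on_subset[OF c2(2) a_sub]] by blast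
  have A_SO_V1: "A \<in> \<S> (\<O> V1)"
  proof -
    have "preimage ` carrier (open_algebra B2) \<subseteq> carrier (open_algebra B1)"
      using homD(1)[OF preimage_hom] by blast
    then have "inj_on (c1 \<circ> preimage) (carrier (open_algebra B2))"
      using comp_inj_on[OF preimage_inj] inj_on_subset[OF c1(2)] by blast
    then have "inj_on ((c1 \<circ> preimage) \<circ> a) (carrier A)"
      using comp_inj_on[OF a_inj] inj_on_subset a_sub by blast
    then show ?thesis
      unfolding SO[OF sub(1)]
      using A_alg C1_V1 hom_comp[OF a hom_comp[OF preimage_hom c1(1)]] by blast
  qed

  have A_notin_O_V1: "A \<notin> \<O> V1"
  proof
    assume "A \<in> \<O> V1"
    then obtain B h where B: "B \<in> V1" and h: "h \<in> hom A (open_algebra B)"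
      "bij_betw h (carrier A) (carrier (open_algebra B))"
      by (auto simp: open_algebras_def isomorphic_def)
    then show False
      using open_B2_not_open_algebra[OF _ hom_comp[OF a'(1) h(1)] bij_betw_trans[OF a'(2) h(2)]]
      by (simp add: V1)
  qed
  have no_embedding: False
    if "B \<in> V1 \<inter> W" "h \<in> hom (open_algebra B2) (open_algebra B)" "inj_on h (carrier (open_algebra B2))" for B h
    using that MGrz(1) open_B2_not_embedded[of B h] by (auto simp: V1 W_def variety_of_def)
  have A_notin_SO_Int: "A \<notin> \<S> (\<O> (V1 \<inter> W))"
  proof
    assume "A \<in> \<S> (\<O> (V1 \<inter> W))"
    then obtain B h where B: "B \<in> V1 \<inter> W" and h: "h \<in> hom A (open_algebra B)" "inj_on h (carrier A)"
      using SO[of "V1 \<inter> W"] sub by blast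
    have "inj_on (h \<circ> a') (carrier (open_algebra B2))"
      using a'(2) h(2) by (auto simp: bij_betw_def intro: comp_inj_on)
    then show False
      using no_embedding[OF B hom_comp[OF a'(1) h(1)]] by blast
  qed

  have identities: "D \<Turnstile> (s, t)"
    if "B \<in> J" "is_algebra D" "h \<in> hom D (open_algebra B)" "inj_on h (carrier D)"
      "wf_trm s" "wf_trm t" "open_algebra B1 \<Turnstile> (s, t)" for B D h s t
    using satisfies_if_embeds[OF that(2-6)] open_algebra_identities[OF _ that(7,5,6)] that(1)
    unfolding J_def by blast

  have "\<O> V1 \<subseteq> monadic_heyting_algebras"
  proof
    fix D assume "D \<in> \<O> V1"
    then obtain B h where B: "B \<in> V1" "is_algebra D" "h \<in> hom D (open_algebra B)" "inj_on h (carrier D)"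
      by (auto simp: open_algebras_def isomorphic_def bij_betw_def)
    then have "D \<Turnstile> e" if "e \<in> monadic_heyting_identities" for e
      using identities[of B D h "fst e" "snd e"] K1.open_complex_monadic_heyting[OF that] sub(1)
        wf_monadic_heyting_identities[of "fst e" "snd e"] that by (auto simp: B1_eq)
    then show "D \<in> monadic_heyting_algebras"
      by (simp add: monadic_heyting_if_identities B(2))
  qed
  moreover have "\<not> variety (\<O> V1)"
    using subalgebras_variety A_SO_V1 A_notin_O_V1 by blast
  moreover have "\<S> (\<O> V1) \<noteq> \<O> (\<S> V1)"
  proof -
    have "\<S> V1 \<subseteq> V1"
      using subalgebras_variety MGrz(1) by (auto simp: variety_of_def)
    then have "\<O> (\<S> V1) \<subseteq> \<O> V1"
      by (auto simp: open_algebras_def)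
    then show ?thesis
      using A_SO_V1 A_notin_O_V1 by blast
  qed
  moreover have "V1 \<subseteq> MS4_algebras"
    using MGrz(1) by (auto simp: variety_of_def MGrz_algebras_def MS4_algebras_def MGrz_on_def)
  moreover have "\<S> (\<O> (V1 \<inter> W)) \<noteq> \<S> (\<O> V1) \<inter> \<S> (\<O> W)"
    using A_SO_V1 A_SO_W A_notin_SO_Int by blast
  moreover have "V1 \<noteq> J"
    using no_embedding[OF _ c2] C2_W sub(2) by blast
  moreover have "\<S> (\<O> V1) = \<S> (\<O> J)"
  proof (intro equalityI subsetI)
    fix D assume "D \<in> \<S> (\<O> V1)"
    then show "D \<in> \<S> (\<O> J)"
      using SO[OF sub(1)] SO[of J] sub(1) by blast
  next
    fix D assume "D \<in> \<S> (\<O> J)"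
    then obtain B h where D: "is_algebra D" and B: "B \<in> J" "h \<in> hom D (open_algebra B)" "inj_on h (carrier D)"
      using SO[of J] by blast
    have "\<exists>C\<in>V1. \<exists>g\<in>hom D (open_algebra C). inj_on g (carrier D)"
      using K1.embeds_in_open_algebra_of_hull[OF D _ inf] identities[OF B(1) D B(2,3)]
      by (auto simp: V1 B1_eq)
    then show "D \<in> \<S> (\<O> V1)"
      using SO[OF sub(1)] D by blast
  qed
  ultimately show ?thesis
    using MGrz by blast
qed

end
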